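(* Let $n\ge2$. The formula $\hat b(f)=b\circ f$ (that is, $b$ applied to each component, $\hat b(f)=(b\circ f_1,\dots,b\circ f_n)$) gives a well-defined map $\hat b\colon \mathrm{map}^{\circ}_{\mathbf{a}}(I^n,\mathrm{Conf}(\mathcal{C},n))\to\mathrm{map}_{\mathbf{a}}(\mathbb{T}^n,\mathrm{Conf}(\mathbb{R}^3,n))$, and $\hat b\circ\check\kappa=\kappa\circ b$ as maps of function spaces $\mathrm{slink}_{\mathbf{a}}(\sqcup_{i=1}^n I_i,\mathcal{C})\to\mathrm{map}_{\mathbf{a}}(\mathbb{T}^n,\mathrm{Conf}(\mathbb{R}^3,n))$. Consequently, on path components, the square with sides $\check\kappa\colon\mathcal{H}(n)\to\mathcal{M}^\circ(n)$, $\hat b\colon\mathcal{M}^\circ(n)\to[\mathbb{T}^n,\mathrm{Conf}(\mathbb{R}^3,n)]$, $b\colon\mathcal{H}(n)\to\mathrm{Link}(n)$ and $\kappa\colon\mathrm{Link}(n)\to[\mathbb{T}^n,\mathrm{Conf}(\mathbb{R}^3,n)]$ commutes: $\hat b\circ\check\kappa=\kappa\circ b$.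
   Context: Let $D^2$ be the unit disk, $I=[0,1]$, $\mathcal{C}=D^2\times I\subset\mathbb{R}^3$, and $\mathbf{a}=(a_1,\dots,a_n)$ an $n$-tuple of distinct marked points in $D^2$. For a space $X$, $\mathrm{Conf}(X,n)=\{(x_1,\dots,x_n)\in X^n: x_i\ne x_j \text{ for } i\ne j\}$. String links: $\mathrm{slink}_{\mathbf{a}}(\sqcup_{i=1}^n I_i,\mathcal{C})$ is the function space of smooth immersions $\sigma=(\sigma_1,\dots,\sigma_n)\colon I_1\sqcup\dots\sqcup I_n\to\mathcal{C}$ ($I_i$ copies of $I$) with $\sigma_i(I_i)\cap\sigma_j(I_j)=\emptyset$ for $i\neq j$, $\sigma_i(0)=(a_i,0)$, $\sigma_i(1)=(a_i,1)$, $\sigma_i((0,1))$ contained in the interior of $\mathcal{C}$, and such that each strand meets $D^2\times\{0\}$ and $D^2\times\{1\}$ orthogonally. $\mathcal{H}(n)$ is $\pi_0$ of this space. Closed links: let $b\colon\mathcal{C}\to\mathcal{T}\subset\mathbb{R}^3$ be an immersion which bends the cylinder $\mathcal{C}$ into a solid torus $\mathcal{T}$ embedded in $\mathbb{R}^3$; under $b$ the bottom disk $D^2\times\{0\}$ is identified with the top disk $D^2\times\{1\}$ into a cross-sectional disk of $\mathcal{T}$, the endpoints of strands are glued, $(a_i,0)\sim(a_i,1)$, and $b$ is an embedding on $\mathrm{int}(\mathcal{C})$. The resulting $n$-tuple of glued points in $\mathbb{R}^3$ is again denoted $\mathbf{a}=(a_1,\dots,a_n)$. $\mathrm{link}_{\mathbf{a}}(\sqcup_{i=1}^nS^1;\mathbb{R}^3)$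 is the function space of smooth immersions $L=(L_1,\dots,L_n)$ of $n$ pointed circles $(S^1,s_i)$ in $\mathbb{R}^3$ with $L_i(S^1)\cap L_j(S^1)=\emptyset$ for $i\ne j$ and $L_i(s_i)=a_i$; $\mathrm{Link}(n)$ is its $\pi_0$. The closure map $b\colon\mathrm{slink}_{\mathbf{a}}(\sqcup_iI_i,\mathcal{C})\to\mathrm{link}_{\mathbf{a}}(\sqcup_iS^1;\mathbb{R}^3)$ sends $\sigma$ to the closed link $b(\sigma)$ with $i$th component $b\circ\sigma_i$, based at $a_i$. Koschorke's map: $\mathbb{T}^n=(S^1)^n$; $\mathrm{map}_{\mathbf{a}}(\mathbb{T}^n,\mathrm{Conf}(\mathbb{R}^3,n))$ is the space of continuous pointed maps (basepoint $\mathbf{a}$ in the target), and $[\mathbb{T}^n,\mathrm{Conf}(\mathbb{R}^3,n)]$ is its $\pi_0$. $\kappa(L)(x_1,\dots,x_n)=(L_1(x_1),\dots,L_n(x_n))$. Mapping space for string links: $\mathrm{map}^\circ_{\mathbf{a}}(I^n,\mathrm{Conf}(\mathcal{C},n))$ is the space of maps $f=(f_1,\dots,f_n)\colon I^n\to\mathrm{Conf}(\mathcal{C},n)$ such that: (endpoints) for all $i$, $f_i$ is constantly $(a_i,0)$ on the face $t_i=0$ and constantly $(a_i,1)$ on the face $t_i=1$; (support) $f(\mathrm{int}(I^n))\subset\mathrm{int}(\mathrm{Conf}(\mathcal{C},n))$; (periodicity) for all $i$ and all $k\neq i$, the restrictions of $f_k$ to the faces $t_i=0$ and $t_i=1$ coincide.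 $\mathcal{M}^\circ(n)=\pi_0(\mathrm{map}^\circ_{\mathbf{a}}(I^n,\mathrm{Conf}(\mathcal{C},n)))$. $\check\kappa(\sigma)(t_1,\dots,t_n)=(\sigma_1(t_1),\dots,\sigma_n(t_n))$. The map $b\circ f$ on $I^n$ is regarded as a map on $\mathbb{T}^n$, obtained from $I^n$ by identifying opposite faces. The same symbols denote maps of function spaces and the maps induced on $\pi_0$.
   Formalization: Two repairs: the support condition is also imposed on proper faces of I^n (components with interior coordinates lie in int C; needed for n≥3, vacuous for n=2), and strands meeting the ends orthogonally must also have all derivatives agree at 0 and 1, so that b(σ) is smooth. *)

theory Defs
  imports "HOL-Analysis.Analysis"
begin

text \<open>
  The number of strands is the cardinality of the finite index type \<open>'n\<close>.  The cylinder lives in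
  \<open>(real^2) \<times> real\<close>, a Euclidean space isometric to $R^3$; closed links live in \<open>real^3\<close>.
\<close>

definition Conf :: "'a set \<Rightarrow> ('a^'n) set" where
  "Conf X = {x. (\<forall>i. x $ i \<in> X) \<and> (\<forall>i j. i \<noteq> j \<longrightarrow> x $ i \<noteq> x $ j)}"

definition cylinder :: "((real^2) \<times> real) set" where
  "cylinder = cball 0 1 \<times> {0..1}"

definition unit_cube :: "(real^'n) set" where
  "unit_cube = {t. \<forall>i. t $ i \<in> {0..1}}"

definition circle :: "complex set" where
  "circle = sphere 0 1"

definition torus :: "(complex^'n) set" where
  "torus = {x. \<forall>i. x $ i \<in> circle}"

text \<open>
  The circle is the quotient of \<open>{0..1}\<close> by \<open>wrap\<close>; its base point is \<open>wrap 0 = wrap 1 = 1\<close>.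
  A function that is constant on the fibres of \<open>wrap\<close> (or \<open>wrap_torus\<close>) descends to the quotient
  by precomposition with \<open>unwrap\<close> (or \<open>unwrap_torus\<close>).
\<close>

definition wrap :: "real \<Rightarrow> complex" where
  "wrap t = cis (2 * pi * t)"

definition unwrap :: "complex \<Rightarrow> real" where
  "unwrap x = Arg2pi x / (2 * pi)"

definition wrap_torus :: "real^'n \<Rightarrow> complex^'n" where
  "wrap_torus t = (\<chi> i. wrap (t $ i))"

definition unwrap_torus :: "complex^'n \<Rightarrow> real^'n" where
  "unwrap_torus x = (\<chi> i. unwrap (x $ i))"

section \<open>Smooth maps\<close>

text \<open>Only used for open sets \<open>S\<close>.\<close>

fun Ck_on :: "nat \<Rightarrow> 'a::real_normed_vector set \<Rightarrow> ('a \<Rightarrow> 'b::real_normed_vector) \<Rightarrow> bool" where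
  "Ck_on 0 S f \<longleftrightarrow> continuous_on S f"
| "Ck_on (Suc k) S f \<longleftrightarrow>
     f differentiable_on S \<and> (\<forall>v. Ck_on k S (\<lambda>x. frechet_derivative f (at x) v))"

definition smooth_on :: "'a::real_normed_vector set \<Rightarrow> ('a \<Rightarrow> 'b::real_normed_vector) \<Rightarrow> bool" where
  "smooth_on S f \<longleftrightarrow> (\<forall>k. Ck_on k S f)"

text \<open>Derivatives of curves are taken within \<open>J\<close>, hence one-sided at the ends of \<open>J = {0..1}\<close>.\<close>

primrec iter_deriv :: "real set \<Rightarrow> nat \<Rightarrow> (real \<Rightarrow> 'a::real_normed_vector) \<Rightarrow> real \<Rightarrow> 'a" where
  "iter_deriv J 0 c = c"
| "iter_deriv J (Suc k) c = (\<lambda>t. vector_derivative (iter_deriv J k c) (at t within J))"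

definition smooth_immersed_curve :: "real set \<Rightarrow> (real \<Rightarrow> 'a::real_normed_vector) \<Rightarrow> bool" where
  "smooth_immersed_curve J c \<longleftrightarrow>
     (\<forall>k. iter_deriv J k c differentiable_on J) \<and> (\<forall>t\<in>J. iter_deriv J 1 c t \<noteq> 0)"

section \<open>Function space topologies\<close>

text \<open>
  All domains are compact, so the compact-open topology is that of uniform convergence, and the
  smooth topology is that of uniform convergence of all derivatives.
\<close>

definition uniform_topology ::
  "'a::topological_space set \<Rightarrow> ('a \<Rightarrow> 'b::metric_space) topology" where
  "uniform_topology K = mtopology_of (cfunspace (top_of_set K) euclidean_metric)"

definition jets :: "real set \<Rightarrow> ('n \<Rightarrow> real \<Rightarrow> 'a::real_normed_vector) \<Rightarrow> nat \<times> 'n \<Rightarrow> real \<Rightarrow> 'a" where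
  "jets J c = (\<lambda>(k, i). restrict (iter_deriv J k (c i)) {0..1})"

definition jet_topology :: "(nat \<times> 'n \<Rightarrow> real \<Rightarrow> 'a::real_normed_vector) topology" where
  "jet_topology = product_topology (\<lambda>_. uniform_topology {0..1}) UNIV"

section \<open>String links\<close>

text \<open>
  The strands are read as meeting the two end disks orthogonally in such a way that their closures
  are smooth.  Orthogonality alone gives \<open>\<sigma>'(0)\<close> and \<open>\<sigma>'(1)\<close> the same direction only; the closed
  curve is smooth at the glued point exactly if all derivatives of \<open>\<sigma>\<close> at 0 and 1 agree.
\<close>

definition meets_ends_orthogonally :: "(real \<Rightarrow> (real^2) \<times> real) \<Rightarrow> bool" where
  "meets_ends_orthogonally c \<longleftrightarrow>
     (\<forall>v. orthogonal (iter_deriv {0..1} 1 c 0) (v, 0)) \<and>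
     (\<forall>v. orthogonal (iter_deriv {0..1} 1 c 1) (v, 0)) \<and>
     (\<forall>k\<ge>1. iter_deriv {0..1} k c 0 = iter_deriv {0..1} k c 1)"

definition slink :: "(real^2)^'n \<Rightarrow> ('n \<Rightarrow> real \<Rightarrow> (real^2) \<times> real) set" where
  "slink a = {\<sigma>.
     (\<forall>i. \<sigma> i \<in> extensional {0..1}) \<and>
     (\<forall>i. \<sigma> i ` {0..1} \<subseteq> cylinder) \<and>
     (\<forall>i. smooth_immersed_curve {0..1} (\<sigma> i)) \<and>
     (\<forall>i j. i \<noteq> j \<longrightarrow> \<sigma> i ` {0..1} \<inter> \<sigma> j ` {0..1} = {}) \<and>
     (\<forall>i. \<sigma> i 0 = (a $ i, 0) \<and> \<sigma> i 1 = (a $ i, 1)) \<and>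
     (\<forall>i. \<sigma> i ` {0<..<1} \<subseteq> interior cylinder) \<and>
     (\<forall>i. meets_ends_orthogonally (\<sigma> i))}"

definition slink_space :: "(real^2)^'n \<Rightarrow> ('n \<Rightarrow> real \<Rightarrow> (real^2) \<times> real) topology" where
  "slink_space a = pullback_topology (slink a) (jets {0..1}) jet_topology"

section \<open>Closed links\<close>

text \<open>
  \<open>B\<close> is the smooth periodic extension of \<open>b\<close> to the infinite cylinder; its existence says that
  the bent cylinder closes up smoothly.  The last clause says that the bottom disk is glued to the
  top disk by \<open>(x, 0) \<sim> (x, 1)\<close> and that there are no other identifications, so that \<open>b\<close> induces
  an embedding of the solid torus.
\<close>

definition bends_cylinder :: "((real^2) \<times> real \<Rightarrow> real^3) \<Rightarrow> bool" where
  "bends_cylinder b \<longleftrightarrow>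
     (\<exists>U B. open U \<and> cball 0 1 \<times> UNIV \<subseteq> U \<and> smooth_on U B \<and>
        (\<forall>p \<in> cball 0 1 \<times> UNIV. inj (frechet_derivative B (at p))) \<and>
        (\<forall>x \<in> cball 0 1. \<forall>z. B (x, z + 1) = B (x, z)) \<and>
        (\<forall>p \<in> cylinder. b p = B p)) \<and>
     (\<forall>p \<in> cylinder. \<forall>q \<in> cylinder.
        b p = b q \<longleftrightarrow> p = q \<or> (fst p = fst q \<and> {snd p, snd q} = {0, 1}))"

definition glued_points :: "((real^2) \<times> real \<Rightarrow> real^3) \<Rightarrow> (real^2)^'n \<Rightarrow> (real^3)^'n" where
  "glued_points b a = (\<chi> i. b (a $ i, 0))"

definition link :: "(real^3)^'n \<Rightarrow> ('n \<Rightarrow> complex \<Rightarrow> real^3) set" where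
  "link a = {L.
     (\<forall>i. L i \<in> extensional circle) \<and>
     (\<forall>i. smooth_immersed_curve UNIV (L i \<circ> wrap)) \<and>
     (\<forall>i j. i \<noteq> j \<longrightarrow> L i ` circle \<inter> L j ` circle = {}) \<and>
     (\<forall>i. L i 1 = a $ i)}"

definition link_space :: "(real^3)^'n \<Rightarrow> ('n \<Rightarrow> complex \<Rightarrow> real^3) topology" where
  "link_space a =
     pullback_topology (link a) (\<lambda>L. jets UNIV (\<lambda>i. L i \<circ> wrap)) jet_topology"

definition closure_map ::
  "((real^2) \<times> real \<Rightarrow> real^3) \<Rightarrow> ('n \<Rightarrow> real \<Rightarrow> (real^2) \<times> real) \<Rightarrow> 'n \<Rightarrow> complex \<Rightarrow> real^3" where
  "closure_map b \<sigma> = (\<lambda>i. \<lambda>x\<in>circle. b (\<sigma> i (unwrap x)))"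

section \<open>Mapping spaces\<close>

definition torus_maps :: "(real^3)^'n \<Rightarrow> (complex^'n \<Rightarrow> (real^3)^'n) set" where
  "torus_maps a = {g. g \<in> extensional torus \<and> continuous_on torus g \<and>
     g ` torus \<subseteq> Conf UNIV \<and> g (\<chi> i. 1) = a}"

definition torus_map_space :: "(real^3)^'n \<Rightarrow> (complex^'n \<Rightarrow> (real^3)^'n) topology" where
  "torus_map_space a = subtopology (uniform_topology torus) (torus_maps a)"

definition kappa :: "('n \<Rightarrow> complex \<Rightarrow> real^3) \<Rightarrow> complex^'n \<Rightarrow> (real^3)^'n" where
  "kappa L = (\<lambda>x\<in>torus. \<chi> i. L i (x $ i))"

definition endpoints :: "(real^2)^'n \<Rightarrow> (real^'n \<Rightarrow> ((real^2) \<times> real)^'n) \<Rightarrow> bool" where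
  "endpoints a f \<longleftrightarrow> (\<forall>t\<in>unit_cube. \<forall>i.
     (t $ i = 0 \<longrightarrow> f t $ i = (a $ i, 0)) \<and> (t $ i = 1 \<longrightarrow> f t $ i = (a $ i, 1)))"

definition interior_support :: "(real^'n \<Rightarrow> ((real^2) \<times> real)^'n) \<Rightarrow> bool" where
  "interior_support f \<longleftrightarrow> f ` interior unit_cube \<subseteq> interior (Conf cylinder)"

definition periodicity :: "(real^'n \<Rightarrow> ((real^2) \<times> real)^'n) \<Rightarrow> bool" where
  "periodicity f \<longleftrightarrow> (\<forall>i k. k \<noteq> i \<longrightarrow> (\<forall>t\<in>unit_cube. \<forall>u\<in>unit_cube.
     t $ i = 0 \<and> u $ i = 1 \<and> (\<forall>j. j \<noteq> i \<longrightarrow> t $ j = u $ j) \<longrightarrow> f t $ k = f u $ k))"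

text \<open>
  The three conditions above do not make \<open>b \<circ> f\<close> a configuration if there are at least three
  strands: on a face of the cube two other components may sit at \<open>(x, 0)\<close> and \<open>(x, 1)\<close>, which
  \<open>b\<close> identifies (see \<open>facewise_support_needed\<close>).  The support condition is therefore imposed on
  the proper faces too: components whose own coordinates are interior lie in the interior of
  the cylinder.  Only faces of dimension at least two are constrained, so for two strands
  nothing is added (see \<open>facewise_support_two_strands\<close>).
\<close>

definition facewise_support :: "(real^'n \<Rightarrow> ((real^2) \<times> real)^'n) \<Rightarrow> bool" where
  "facewise_support f \<longleftrightarrow> (\<forall>t \<in> unit_cube - interior unit_cube. \<forall>j k.
     j \<noteq> k \<and> t $ j \<in> {0<..<1} \<and> t $ k \<in> {0<..<1} \<longrightarrow>
     f t $ j \<in> interior cylinder \<and> f t $ k \<in> interior cylinder)"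

definition cube_maps :: "(real^2)^'n \<Rightarrow> (real^'n \<Rightarrow> ((real^2) \<times> real)^'n) set" where
  "cube_maps a = {f. f \<in> extensional unit_cube \<and> continuous_on unit_cube f \<and>
     f ` unit_cube \<subseteq> Conf cylinder \<and>
     endpoints a f \<and> interior_support f \<and> periodicity f \<and> facewise_support f}"

definition cube_map_space :: "(real^2)^'n \<Rightarrow> (real^'n \<Rightarrow> ((real^2) \<times> real)^'n) topology" where
  "cube_map_space a = subtopology (uniform_topology unit_cube) (cube_maps a)"

definition kappa_check ::
  "('n \<Rightarrow> real \<Rightarrow> (real^2) \<times> real) \<Rightarrow> real^'n \<Rightarrow> ((real^2) \<times> real)^'n" where
  "kappa_check \<sigma> = (\<lambda>t\<in>unit_cube. \<chi> i. \<sigma> i (t $ i))"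

definition b_hat :: "((real^2) \<times> real \<Rightarrow> real^3) \<Rightarrow> (real^'n \<Rightarrow> ((real^2) \<times> real)^'n)
    \<Rightarrow> complex^'n \<Rightarrow> (real^3)^'n" where
  "b_hat b f = (\<lambda>x\<in>torus. \<chi> i. b (f (unwrap_torus x) $ i))"

text \<open>\<open>path_components_of X\<close> is the set of path components; a continuous map induces:\<close>

definition pi0_map :: "'a topology \<Rightarrow> 'b topology \<Rightarrow> ('a \<Rightarrow> 'b) \<Rightarrow> 'a set \<Rightarrow> 'b set" where
  "pi0_map X Y f P = (THE Q. Q \<in> path_components_of Y \<and> f ` P \<subseteq> Q)"

section \<open>Sanity checks\<close>

lemma interior_unit_cube:
  "interior (unit_cube :: (real^'n) set) = {t. \<forall>i. t $ i \<in> {0<..<1}}"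
proof -
  have "unit_cube = cbox (0 :: real^'n) 1"
    by (auto simp: unit_cube_def mem_box_cart)
  moreover have "box (0 :: real^'n) 1 = {t. \<forall>i. t $ i \<in> {0<..<1}}"
    by (auto simp: mem_box_cart)
  ultimately show ?thesis
    by (metis interior_cbox)
qed

lemma facewise_support_two_strands:
  fixes f :: "real^'n \<Rightarrow> ((real^2) \<times> real)^'n"
  assumes "CARD('n) = 2"
  shows "facewise_support f"
  unfolding facewise_support_def
proof (intro ballI allI impI, elim conjE)
  fix t :: "real^'n" and j k
  assume t: "t \<in> unit_cube - interior unit_cube" and jk: "j \<noteq> k"
    and tj: "t $ j \<in> {0<..<1}" and tk: "t $ k \<in> {0<..<1}"
  have "UNIV = {j, k}"
    using jk assms by (intro sym[OF card_subset_eq]) auto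
  then have "\<forall>i. t $ i \<in> {0<..<1}"
    using tj tk by (metis UNIV_I empty_iff insert_iff)
  then show "f t $ j \<in> interior cylinder \<and> f t $ k \<in> interior cylinder"
    using t by (simp add: interior_unit_cube)
qed

lemma interior_cylinder: "interior cylinder = ball 0 1 \<times> {0<..<1}"
  by (simp add: cylinder_def interior_Times)

lemma open_Conf:
  fixes S :: "'a::t2_space set"
  assumes "open S"
  shows "open (Conf S :: ('a^'n) set)"
proof -
  have "Conf S = (\<Inter>i::'n. (\<lambda>x. x $ i) -` S) \<inter> (\<Inter>i::'n. \<Inter>j\<in>-{i}. {x. x $ i \<noteq> x $ j})"
    by (auto simp: Conf_def)
  moreover have "open ((\<lambda>x. x $ i) -` S)" for i :: 'n
    using assms by (rule open_vimage_vec_nth)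
  moreover have "open {x :: 'a^'n. x $ i \<noteq> x $ j}" for i j
    by (intro open_Collect_neq continuous_intros)
  ultimately show ?thesis
    by (auto intro!: open_INT open_Int)
qed

lemma facewise_support_needed:
  "\<exists>(a :: (real^2)^3) f. a \<in> Conf (cball 0 1) \<and>
     f \<in> extensional unit_cube \<and> continuous_on unit_cube f \<and> f ` unit_cube \<subseteq> Conf cylinder \<and>
     endpoints a f \<and> interior_support f \<and> periodicity f \<and>
     (\<forall>b. bends_cylinder b \<longrightarrow> b_hat b f \<notin> torus_maps (glued_points b a))"
proof -
  define e where "e = (axis 1 1 :: real^2)"
  define e' where "e' = (axis 2 1 :: real^2)"
  have norm_e: "norm e = 1" "norm e' = 1"
    by (simp_all add: e_def e'_def)
  have e_ne: "x *\<^sub>R e \<noteq> (1/2) *\<^sub>R e'" "(1/2) *\<^sub>R e' \<noteq> x *\<^sub>R e" for x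
    by (auto simp: e_def e'_def vec_eq_iff axis_def forall_2)
  have e_eq: "x *\<^sub>R e = y *\<^sub>R e \<longleftrightarrow> x = y" for x y
    using norm_e by auto
  define s where "s = (\<lambda>t :: real^3. 2 * (t $ 1 * (1 - t $ 1)))"
  define h2 where "h2 = (\<lambda>t :: real^3. s t * t $ 2 + (1 - s t) * max 0 (2 * t $ 2 - 1))"
  define h3 where "h3 = (\<lambda>t :: real^3. s t * t $ 3 + (1 - s t) * min 1 (2 * t $ 3))"
  define F where "F = (\<lambda>t :: real^3. (\<chi> i :: 3.
      if i = 1 then ((1/2) *\<^sub>R e', t $ 1)
      else if i = 2 then ((- \<bar>t $ 2 - 1/2\<bar>) *\<^sub>R e, h2 t)
      else (\<bar>t $ 3 - 1/2\<bar> *\<^sub>R e, h3 t)))"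
  have F: "F t $ 1 = ((1/2) *\<^sub>R e', t $ 1)" "F t $ 2 = ((- \<bar>t $ 2 - 1/2\<bar>) *\<^sub>R e, h2 t)"
    "F t $ 3 = (\<bar>t $ 3 - 1/2\<bar> *\<^sub>R e, h3 t)" for t
    by (simp_all add: F_def)
  define a :: "(real^2)^3" where "a = (\<chi> i.
      if i = 1 then (1/2) *\<^sub>R e' else if i = 2 then (-1/2) *\<^sub>R e else (1/2) *\<^sub>R e)"
  have a: "a $ 1 = (1/2) *\<^sub>R e'" "a $ 2 = (-1/2) *\<^sub>R e" "a $ 3 = (1/2) *\<^sub>R e"
    by (simp_all add: a_def)
  define f where "f = restrict F unit_cube"

  have s_bounds: "0 \<le> s t" "s t \<le> 1/2" if "t \<in> unit_cube" for t
  proof -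
    have *: "0 \<le> t $ 1" "t $ 1 \<le> 1"
      using that by (auto simp: unit_cube_def)
    then show "0 \<le> s t"
      by (simp add: s_def)
    have "0 \<le> (2 * t $ 1 - 1)\<^sup>2"
      by simp
    then show "s t \<le> 1/2"
      by (simp add: s_def power2_eq_square algebra_simps)
  qed
  have h_mid: "h2 t \<noteq> h3 t" if "t \<in> unit_cube" "t $ 2 = 1/2" "t $ 3 = 1/2" for t
    using s_bounds[OF that(1)] unfolding h2_def h3_def that(2,3) by simp
  have F_distinct: "F t $ i \<noteq> F t $ j" if "t \<in> unit_cube" "i \<noteq> j" for t i j
  proof -
    have "F t $ 1 \<noteq> F t $ 2" "F t $ 1 \<noteq> F t $ 3"
      unfolding F using e_ne by blast+
    moreover have "F t $ 2 \<noteq> F t $ 3"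
    proof
      assume "F t $ 2 = F t $ 3"
      then have "- \<bar>t $ 2 - 1/2\<bar> = \<bar>t $ 3 - 1/2\<bar>" "h2 t = h3 t"
        unfolding F prod.inject e_eq by auto
      moreover from this have "t $ 2 = 1/2" "t $ 3 = 1/2"
        by linarith+
      ultimately show False
        using h_mid that(1) by blast
    qed
    ultimately show ?thesis
      using that(2) exhaust_3[of i] exhaust_3[of j] by metis
  qed
  have conv: "(1 - r) * x + r * y \<in> T" if "x \<in> T" "y \<in> T" "convex T" "0 \<le> r" "r \<le> 1"
    for r x y :: real and T
    using that convexD_alt[of T x y r] by simp
  have h2_in: "h2 t \<in> {0..1}" and h3_in: "h3 t \<in> {0..1}" if t: "t \<in> unit_cube" for t
  proof -
    have *: "t $ 2 \<in> {0..1}" "t $ 3 \<in> {0..1}"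
      using t by (auto simp: unit_cube_def)
    then have **: "max 0 (2 * t $ 2 - 1) \<in> {0..1}" "min 1 (2 * t $ 3) \<in> {0..1}"
      by auto
    show "h2 t \<in> {0..1}"
      using conv[OF **(1) *(1) convex_real_interval(5), of "s t"] s_bounds[OF t]
      by (simp add: h2_def add.commute)
    show "h3 t \<in> {0..1}"
      using conv[OF **(2) *(2) convex_real_interval(5), of "s t"] s_bounds[OF t]
      by (simp add: h3_def add.commute)
  qed
  have F_cyl: "F t $ i \<in> cylinder" if t: "t \<in> unit_cube" for t i
  proof -
    have *: "t $ k \<in> {0..1}" for k
      using t by (auto simp: unit_cube_def)
    show ?thesis
      using *[of 1] *[of 2] *[of 3] h2_in[OF t] h3_in[OF t] exhaust_3[of i]
      by (auto simp: F cylinder_def norm_e)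
  qed
  have F_int: "F t $ i \<in> interior cylinder" if t: "t \<in> interior unit_cube" for t i
  proof -
    have tc: "t \<in> unit_cube"
      using t interior_subset by blast
    have *: "0 < t $ k" "t $ k < 1" for k
      using t by (auto simp: interior_unit_cube)
    have s0: "0 < s t"
      using *[of 1] by (simp add: s_def)
    have s1: "0 < 1 - s t"
      using s_bounds[OF tc] by simp
    have "0 < s t * t $ 2" "0 \<le> (1 - s t) * max 0 (2 * t $ 2 - 1)"
      using *[of 2] s0 s1 by auto
    then have a1: "0 < h2 t"
      by (simp add: h2_def)
    have "s t * t $ 2 < s t" "(1 - s t) * max 0 (2 * t $ 2 - 1) \<le> 1 - s t"
      using *[of 2] s0 s1 by (auto simp: mult_le_cancel_left1)
    then have a2: "h2 t < 1"
      by (simp add: h2_def)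
    have "0 < s t * t $ 3" "0 \<le> (1 - s t) * min 1 (2 * t $ 3)"
      using *[of 3] s0 s1 by auto
    then have a3: "0 < h3 t"
      by (simp add: h3_def)
    have "s t * t $ 3 < s t" "(1 - s t) * min 1 (2 * t $ 3) \<le> 1 - s t"
      using *[of 3] s0 s1 by (auto simp: mult_le_cancel_left1)
    then have a4: "h3 t < 1"
      by (simp add: h3_def)
    show ?thesis
      using *[of 1] *[of 2] *[of 3] a1 a2 a3 a4 exhaust_3[of i]
      by (auto simp: F interior_cylinder norm_e)
  qed

  have "a $ i \<noteq> a $ j" if "i \<noteq> j" for i j
  proof -
    have "a $ 1 \<noteq> a $ 2" "a $ 1 \<noteq> a $ 3"
      unfolding a using e_ne by blast+
    moreover have "a $ 2 \<noteq> a $ 3"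
      unfolding a e_eq by simp
    ultimately show ?thesis
      using that exhaust_3[of i] exhaust_3[of j] by metis
  qed
  moreover have "a $ i \<in> cball 0 1" for i
    using exhaust_3[of i] by (auto simp: a norm_e)
  ultimately have "a \<in> Conf (cball 0 1)"
    by (simp add: Conf_def)
  moreover have "f \<in> extensional unit_cube"
    by (simp add: f_def)
  moreover have "continuous_on unit_cube f"
  proof -
    have "continuous_on unit_cube (\<lambda>t. F t $ 1)" "continuous_on unit_cube (\<lambda>t. F t $ 2)"
      "continuous_on unit_cube (\<lambda>t. F t $ 3)"
      unfolding F h2_def h3_def s_def by (intro continuous_intros)+
    then have "continuous_on unit_cube (\<lambda>t. F t $ i)" for i
      using exhaust_3[of i] by metis
    then have "continuous_on unit_cube (\<lambda>t. \<chi> i. F t $ i)"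
      by (rule continuous_on_vec_lambda)
    then show ?thesis
      by (simp add: f_def cong: continuous_on_cong)
  qed
  moreover have "f ` unit_cube \<subseteq> Conf cylinder"
    using F_cyl F_distinct by (auto simp: f_def Conf_def)
  moreover have "endpoints a f"
  proof -
    have "(t $ i = 0 \<longrightarrow> F t $ i = (a $ i, 0)) \<and> (t $ i = 1 \<longrightarrow> F t $ i = (a $ i, 1))" for t i
      using exhaust_3[of i] by (auto simp: F a h2_def h3_def)
    then show ?thesis
      by (simp add: endpoints_def f_def)
  qed
  moreover have "interior_support f"
  proof -
    have "f ` interior unit_cube \<subseteq> Conf (interior cylinder)"
      using F_int F_distinct interior_subset by (force simp: f_def Conf_def)
    also have "\<dots> \<subseteq> interior (Conf cylinder)"
      using interior_subset by (intro interior_maximal open_Conf) (auto simp: Conf_def)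
    finally show ?thesis
      by (simp add: interior_support_def)
  qed
  moreover have "periodicity f"
  proof -
    have "F t $ k = F u $ k"
      if "k \<noteq> i" "t $ i = 0" "u $ i = 1" "\<forall>j. j \<noteq> i \<longrightarrow> t $ j = u $ j" for i k t u
    proof -
      have "s t = s u"
        using that by (cases "i = 1") (auto simp: s_def)
      then show ?thesis
        using that exhaust_3[of k] by (auto simp: F h2_def h3_def)
    qed
    then show ?thesis
      by (simp add: periodicity_def f_def)
  qed
  moreover have "b_hat b f \<notin> torus_maps (glued_points b a)" if b: "bends_cylinder b" for b
  proof
    assume "b_hat b f \<in> torus_maps (glued_points b a)"
    then have sub: "b_hat b f ` torus \<subseteq> Conf UNIV"
      by (simp add: torus_maps_def)
    define x :: "complex^3" where "x = (\<chi> i. if i = 1 then 1 else -1)"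
    have x: "x \<in> torus"
      by (simp add: x_def torus_def circle_def)
    define t :: "real^3" where "t = unwrap_torus x"
    have "Arg2pi (-1) = pi"
      by (rule Arg2pi_unique[of 1]) auto
    then have t: "t $ 1 = 0" "t $ 2 = 1/2" "t $ 3 = 1/2"
      by (simp_all add: t_def unwrap_torus_def unwrap_def x_def Arg2pi_of_real[of 1, simplified])
    then have "t \<in> unit_cube"
      by (simp add: unit_cube_def forall_3)
    then have "f t $ 2 = (0, 0)" "f t $ 3 = (0, 1)"
      by (simp_all add: f_def F t h2_def h3_def s_def)
    moreover have "b (0, 0) = b (0, 1)"
      using b unfolding bends_cylinder_def cylinder_def by fastforce
    ultimately have "b_hat b f x $ 2 = b_hat b f x $ 3"
      using x by (simp add: b_hat_def t_def)
    moreover have "b_hat b f x \<in> Conf UNIV"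
      using sub x by blast
    moreover have "(2::3) \<noteq> 3"
      by simp
    ultimately show False
      unfolding Conf_def by blast
  qed
  ultimately show ?thesis
    by blast
qed

lemma closure_map_wrap:
  assumes "bends_cylinder b" "a \<in> Conf (cball 0 1)" "\<sigma> \<in> slink a" "t \<in> {0..1}"
  shows "closure_map b \<sigma> i (wrap t) = b (\<sigma> i t)"
proof -
  have circ: "wrap t \<in> circle"
    by (simp add: wrap_def circle_def)
  have ends: "b (a $ i, 0) = b (a $ i, 1)"
    using assms(1,2) unfolding bends_cylinder_def Conf_def cylinder_def by fastforce
  show ?thesis
  proof (cases "t = 1")
    case True
    then have "unwrap (wrap t) = 0"
      by (simp add: wrap_def unwrap_def Arg2pi_of_real[of 1, simplified])
    then show ?thesis
      using circ True ends assms(3) by (simp add: closure_map_def slink_def)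
  next
    case False
    then have "2 * pi * t < 2 * pi"
      using assms(4) by simp
    then have "Arg2pi (wrap t) = 2 * pi * t"
      using assms(4) unfolding wrap_def cis_conv_exp
      by (intro Arg2pi_unique[of 1]) auto
    then show ?thesis
      using circ by (simp add: closure_map_def unwrap_def)
  qed
qed

lemma topspace_uniform_topology:
  assumes "compact K"
  shows "topspace (uniform_topology K) = {f \<in> extensional K. continuous_on K f}"
proof -
  have "Met_TC.mbounded (f ` K)" if "continuous_on K f" for f :: "'a \<Rightarrow> 'b"
    using compact_continuous_image[OF that assms]
    by (simp add: compact_imp_bounded)
  then show ?thesis
    by (auto simp: uniform_topology_def)
qed

lemma compact_unit_cube: "compact (unit_cube :: (real^'n) set)"
proof -
  have "unit_cube = cbox (0 :: real^'n) 1"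
    by (auto simp: unit_cube_def mem_box_cart)
  then show ?thesis
    by (metis compact_cbox)
qed

lemma compact_torus: "compact (torus :: (complex^'n) set)"
proof -
  have "torus = (wrap_torus ` unit_cube :: (complex^'n) set)"
  proof (intro equalityI subsetI)
    fix x :: "complex^'n" assume x: "x \<in> torus"
    have "wrap (unwrap (x $ i)) = x $ i" for i
      using x Arg2pi_eq[of "x $ i"]
      by (simp add: torus_def circle_def wrap_def unwrap_def cis_conv_exp)
    then have "x = wrap_torus (unwrap_torus x)"
      by (simp add: wrap_torus_def unwrap_torus_def vec_eq_iff)
    moreover have "unwrap_torus x \<in> unit_cube"
      using Arg2pi_ge_0 Arg2pi_lt_2pi
      by (simp add: unwrap_torus_def unit_cube_def unwrap_def less_imp_le)
    ultimately show "x \<in> wrap_torus ` unit_cube"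
      by blast
  qed (auto simp: torus_def wrap_torus_def wrap_def circle_def)
  moreover have "continuous_on unit_cube (wrap_torus :: real^'n \<Rightarrow> complex^'n)"
    unfolding wrap_torus_def wrap_def
    by (intro continuous_on_vec_lambda continuous_intros)
  ultimately show ?thesis
    by (metis compact_continuous_image compact_unit_cube)
qed

lemma jets_in_jet_topology:
  assumes "\<And>i. smooth_immersed_curve J (c i)" "{0..1} \<subseteq> J"
  shows "jets J c \<in> topspace jet_topology"
proof -
  have "continuous_on {0..1} (iter_deriv J k (c i))" for k i
    using assms differentiable_imp_continuous_on continuous_on_subset
    unfolding smooth_immersed_curve_def by blast
  then have "continuous_on {0..1} (restrict (iter_deriv J k (c i)) {0..1})" for k i
    by (metis (no_types, lifting) continuous_on_cong restrict_apply)
  then show ?thesis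
    by (auto simp: jet_topology_def jets_def topspace_uniform_topology PiE_def
        simp del: restrict_apply)
qed

lemma topspace_slink_space: "topspace (slink_space a) = slink a"
  using jets_in_jet_topology[of "{0..1}"]
  by (auto simp: slink_space_def topspace_pullback_topology slink_def)

lemma topspace_link_space: "topspace (link_space a) = link a"
proof -
  have "jets UNIV (\<lambda>i. L i \<circ> wrap) \<in> topspace jet_topology" if "L \<in> link a" for L
    using that by (intro jets_in_jet_topology) (auto simp: link_def)
  then show ?thesis
    by (auto simp: link_space_def topspace_pullback_topology)
qed

lemma topspace_cube_map_space: "topspace (cube_map_space a) = cube_maps a"
  by (auto simp: cube_map_space_def topspace_uniform_topology compact_unit_cube cube_maps_def)

lemma topspace_torus_map_space: "topspace (torus_map_space a) = torus_maps a"
  by (auto simp: torus_map_space_def topspace_uniform_topology compact_torus torus_maps_def)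

end

theory Submission
  imports Defs
begin

text \<open>
  Continuity into a space of maps with the uniform topology is a statement about uniform limits
  along the parameter. The torus is a compact quotient of the cube, so maps and families of maps on
  it may be studied on the cube, where the closure operations become postcomposition with \<open>b\<close>,
  which is uniformly continuous on the compact cylinder. The distinctness of the components of
  \<open>b \<circ> f\<close> comes from the support conditions and, on the faces, from periodicity together with the
  fixed end points.

  The closure of a string link is smooth because a loop on \<open>[0,1]\<close> whose derivatives all close up
  extends periodically to a smooth curve. By the chain rule the derivative of \<open>B \<circ> \<sigma>\<close> is a sum of
  products of components of \<open>\<sigma>'\<close> with \<open>B\<^sub>e \<circ> \<sigma>\<close>, where the partial derivative \<open>B\<^sub>e\<close> is again smooth and
  periodic; an induction on the order thus gives the closing conditions and the continuous dependence
  of all derivatives on \<open>\<sigma>\<close>.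
\<close>

section \<open>Topologies of uniform convergence and path components\<close>

text \<open>The metric of \<open>cfunspace\<close> is the supremum distance, and compactness of
  \<open>K\<close> makes every continuous map bounded. The punctured filter \<open>atin X x\<close>
  is enough because \<open>F x\<close> has distance 0 from itself.\<close>

lemma continuous_map_uniform_topology:
  fixes F :: "'x \<Rightarrow> 'a::topological_space \<Rightarrow> 'b::metric_space"
  assumes "compact K"
  shows "continuous_map X (uniform_topology K) F \<longleftrightarrow>
    (\<forall>x\<in>topspace X. F x \<in> extensional K \<and> continuous_on K (F x) \<and>
       uniform_limit K F (F x) (atin X x))"
proof -
  define M where "M = cfunspace (top_of_set K) (euclidean_metric :: 'b metric)"
  interpret M: Metric_space "mspace M" "mdist M"
    by simp
  have top: "uniform_topology K = M.mtopology"
    by (simp add: uniform_topology_def M_def mtopology_of_def)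
  have space: "mspace M = {f \<in> extensional K. continuous_on K f}"
    using topspace_uniform_topology[OF assms, where 'b = 'b] unfolding top by simp
  show ?thesis
  proof (intro iffI ballI conjI)
    fix x assume F: "continuous_map X (uniform_topology K) F" and x: "x \<in> topspace X"
    have Fx: "F y \<in> mspace M" if "y \<in> topspace X" for y
      using continuous_map_image_subset_topspace[OF F] that unfolding top by auto
    then show "F x \<in> extensional K" "continuous_on K (F x)"
      using x by (auto simp: space)
    show "uniform_limit K F (F x) (atin X x)"
    proof (rule uniform_limitI)
      fix e :: real assume "e > 0"
      with F x have "\<exists>U. openin X U \<and> x \<in> U \<and> (\<forall>y\<in>U. F y \<in> M.mball (F x) e)"
        unfolding top M.continuous_map_to_metric by (elim ballE allE[of _ e]) auto
      then obtain U where U: "openin X U" "x \<in> U" "\<And>y. y \<in> U \<Longrightarrow> F y \<in> M.mball (F x) e"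
        by (elim exE conjE) (rule that, assumption, assumption, erule bspec)
      have "dist (F y t) (F x t) < e" if "y \<in> U" "t \<in> K" for y t
      proof -
        have "mdist M (F x) (F y) < e"
          using U(3)[OF that(1)] by simp
        moreover have "mdist euclidean_metric (F x t) (F y t) \<le> mdist M (F x) (F y)"
          unfolding M_def
        proof (rule mdist_cfunspace_imp_mdist_le[OF _ _ order_refl])
          show "F x \<in> mspace (cfunspace (top_of_set K) euclidean_metric)"
            using Fx[OF x] by (simp only: M_def)
          have "y \<in> topspace X"
            using openin_subset[OF U(1)] that(1) by blast
          then show "F y \<in> mspace (cfunspace (top_of_set K) euclidean_metric)"
            using Fx by (simp only: M_def)
          show "t \<in> topspace (top_of_set K)"
            using that(2) by simp
        qed
        then have "dist (F x t) (F y t) \<le> mdist M (F x) (F y)"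
          by (simp only: mdist_euclidean_metric)
        ultimately show ?thesis
          unfolding dist_commute[of "F y t"] by linarith
      qed
      then show "\<forall>\<^sub>F y in atin X x. \<forall>t\<in>K. dist (F y t) (F x t) < e"
        unfolding eventually_atin using U(1,2) by blast
    qed
  next
    assume F: "\<forall>x\<in>topspace X. F x \<in> extensional K \<and> continuous_on K (F x) \<and>
       uniform_limit K F (F x) (atin X x)"
    show "continuous_map X (uniform_topology K) F"
      unfolding top M.continuous_map_to_metric
    proof (intro ballI allI impI)
      fix x and e :: real assume x: "x \<in> topspace X" and e: "e > 0"
      \<comment> \<open>Passing to the supremum over \<open>K\<close> keeps only a non-strict bound;
        aiming at \<open>e / 2\<close> leaves room for the strict one.\<close>
      then have "\<forall>\<^sub>F y in atin X x. \<forall>t\<in>K. dist (F y t) (F x t) < e / 2"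
        using F by (intro uniform_limitD) auto
      then obtain U where U: "openin X U" "x \<in> U"
        "\<And>y t. y \<in> U - {x} \<Longrightarrow> t \<in> K \<Longrightarrow> dist (F y t) (F x t) < e / 2"
        using x unfolding eventually_atin by blast
      have "F y \<in> M.mball (F x) e" if y: "y \<in> U" for y
      proof -
        have "dist (F x t) (F y t) \<le> e / 2" if "t \<in> K" for t
          using U(3)[of y t] y that e by (cases "y = x") (auto simp: dist_commute)
        then have "mdist M (F x) (F y) \<le> e / 2"
          unfolding M_def using e by (intro mdist_cfunspace_le) auto
        moreover have "F x \<in> mspace M" "F y \<in> mspace M"
          using F x y openin_subset[OF U(1)] by (auto simp: space)
        ultimately show ?thesis
          using e by simp
      qed
      then show "\<exists>U. openin X U \<and> x \<in> U \<and> (\<forall>y\<in>U. F y \<in> M.mball (F x) e)"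
        using U(1,2) by (intro exI[of _ U]) simp
    qed
  qed
qed

lemma continuous_map_uniform_topology_restrict:
  fixes F :: "'x \<Rightarrow> 'a::topological_space \<Rightarrow> 'b::metric_space"
  assumes "compact K"
  shows "continuous_map X (uniform_topology K) (\<lambda>x. restrict (F x) K) \<longleftrightarrow>
    (\<forall>x\<in>topspace X. continuous_on K (F x) \<and> uniform_limit K F (F x) (atin X x))"
proof -
  have "continuous_on K (restrict (F x) K) \<longleftrightarrow> continuous_on K (F x)" for x
    by (rule continuous_on_cong) auto
  then show ?thesis
    unfolding continuous_map_uniform_topology[OF assms] uniform_limit_iff by simp
qed

lemma uniform_limit_vec_lambda:
  fixes f :: "'x \<Rightarrow> 'a \<Rightarrow> 'n::finite \<Rightarrow> 'b::metric_space"
  assumes "\<And>i. uniform_limit K (\<lambda>x t. f x t i) (\<lambda>t. l t i) F"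
  shows "uniform_limit K (\<lambda>x t. \<chi> i. f x t i) (\<lambda>t. \<chi> i. l t i) F"
proof (rule uniform_limitI)
  fix e :: real assume "e > 0"
  \<comment> \<open>The distance of two vectors is at most the sum of the component distances; the
    factor 2 makes that sum strictly less than \<open>e\<close>.\<close>
  then have "e / (2 * CARD('n)) > 0"
    by simp
  then have "\<forall>\<^sub>F x in F. \<forall>t\<in>K. dist (f x t i) (l t i) < e / (2 * CARD('n))" for i
    by (rule uniform_limitD[OF assms])
  then have "\<forall>\<^sub>F x in F. \<forall>i. \<forall>t\<in>K. dist (f x t i) (l t i) < e / (2 * CARD('n))"
    by (simp add: eventually_all_finite)
  then show "\<forall>\<^sub>F x in F. \<forall>t\<in>K. dist (\<chi> i. f x t i) (\<chi> i. l t i) < e"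
  proof (rule eventually_mono, intro ballI)
    fix x t assume *: "\<forall>i. \<forall>t\<in>K. dist (f x t i) (l t i) < e / (2 * CARD('n))" and t: "t \<in> K"
    have "dist (\<chi> i. f x t i) (\<chi> i. l t i) \<le> (\<Sum>i\<in>UNIV. dist (f x t i) (l t i))"
      unfolding dist_vec_def by (simp add: L2_set_le_sum)
    also have "\<dots> \<le> (\<Sum>i\<in>(UNIV :: 'n set). e / (2 * CARD('n)))"
      using * t by (intro sum_mono) (auto intro: less_imp_le)
    also have "\<dots> < e"
      using \<open>e > 0\<close> by simp
    finally show "dist (\<chi> i. f x t i) (\<chi> i. l t i) < e" .
  qed
qed

text \<open>A continuous surjection from a compact space onto a Hausdorff space is a quotient map,
  so openness in \<open>T\<close> can be tested on \<open>S\<close>.\<close>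

lemma continuous_on_compact_quotient:
  fixes q :: "'a::t2_space \<Rightarrow> 'b::t2_space" and g :: "'b \<Rightarrow> 'c::topological_space"
  assumes q: "continuous_on S q" "compact S" "q ` S = T" and g: "continuous_on S (\<lambda>s. g (q s))"
  shows "continuous_on T g"
proof (subst continuous_on_open_gen[where T = UNIV], simp, intro allI impI)
  fix V :: "'c set" assume V: "openin (top_of_set UNIV) V"
  have "S \<inter> q -` (T \<inter> g -` V) = S \<inter> (\<lambda>s. g (q s)) -` V"
    using q(3) by auto
  then have "openin (top_of_set S) (S \<inter> q -` (T \<inter> g -` V))"
    using g V by (simp add: continuous_openin_preimage_gen)
  then show "openin (top_of_set T) (T \<inter> g -` V)"
    using Abstract_Topology_2.continuous_imp_quotient_map[OF q(1,3,2), of "T \<inter> g -` V"] by simp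
qed

section \<open>Continuous families of maps\<close>

text \<open>For compact \<open>K\<close> this is continuity into \<open>uniform_topology K\<close>,
  freed from the convention that maps are \<open>undefined\<close> off \<open>K\<close>. Sums,
  products and compositions can then be formed without restricting.\<close>

definition continuous_family ::
  "'x topology \<Rightarrow> 'a::topological_space set \<Rightarrow> ('x \<Rightarrow> 'a \<Rightarrow> 'b::metric_space) \<Rightarrow> bool" where
  "continuous_family X K F \<longleftrightarrow>
     (\<forall>x\<in>topspace X. continuous_on K (F x) \<and> uniform_limit K F (F x) (atin X x))"

lemma continuous_family_iff:
  "compact K \<Longrightarrow>
    continuous_family X K F \<longleftrightarrow> continuous_map X (uniform_topology K) (\<lambda>x. restrict (F x) K)"
  unfolding continuous_family_def by (rule continuous_map_uniform_topology_restrict[symmetric])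

lemma eventually_atin_in_topspace: "\<forall>\<^sub>F y in atin X x. y \<in> topspace X"
proof -
  \<comment> \<open>Off the space \<open>atin X x\<close> is the trivial filter; on it the whole
    space serves as a neighbourhood.\<close>
  have "x \<notin> topspace X \<or> (openin X (topspace X) \<and> x \<in> topspace X)"
    by auto
  then show ?thesis
    unfolding eventually_atin by (elim disjE) (auto intro!: exI[of _ "topspace X"])
qed

lemma continuous_family_cong:
  assumes "\<And>x t. x \<in> topspace X \<Longrightarrow> t \<in> K \<Longrightarrow> F x t = G x t"
  shows "continuous_family X K F \<longleftrightarrow> continuous_family X K G"
proof -
  have "continuous_on K (F x) = continuous_on K (G x)"
    "uniform_limit K F (F x) (atin X x) = uniform_limit K G (G x) (atin X x)"
    if "x \<in> topspace X" for x
  proof -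
    show "continuous_on K (F x) = continuous_on K (G x)"
      using assms that by (intro continuous_on_cong) auto
    have "\<forall>\<^sub>F y in atin X x. \<forall>t\<in>K. F y t = G y t"
      using eventually_atin_in_topspace by (rule eventually_mono) (use assms in blast)
    then show "uniform_limit K F (F x) (atin X x) = uniform_limit K G (G x) (atin X x)"
      using assms that by (intro uniform_limit_cong) auto
  qed
  then show ?thesis
    by (simp add: continuous_family_def)
qed

text \<open>\<open>B\<close> is uniformly continuous on the compact set \<open>C\<close>, so it
  preserves uniform limits of maps with values in \<open>C\<close>. The nearby members of the
  family, and not only the limit, have to take their values there.\<close>

lemma continuous_family_compose:
  fixes B :: "'b::metric_space \<Rightarrow> 'c::metric_space"
  assumes F: "continuous_family X K F" "\<And>x t. x \<in> topspace X \<Longrightarrow> t \<in> K \<Longrightarrow> F x t \<in> C"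
    and B: "continuous_on C B" "compact C"
  shows "continuous_family X K (\<lambda>x t. B (F x t))"
  unfolding continuous_family_def
proof (intro ballI conjI)
  fix x assume x: "x \<in> topspace X"
  show "continuous_on K (\<lambda>t. B (F x t))"
    using F x by (intro continuous_on_compose2[OF B(1)]) (auto simp: continuous_family_def)
  have "\<forall>\<^sub>F y in atin X x. F y ` K \<subseteq> C"
    using eventually_atin_in_topspace by (rule eventually_mono) (use F(2) in blast)
  moreover have "F x ` K \<subseteq> C"
    using F(2) x by blast
  ultimately have "uniform_limit K (\<lambda>y t. B (F y t)) (B \<circ> F x) (atin X x)"
    using F(1) x B by (intro uniform_limit_compose[where U = C] compact_uniformly_continuous)
      (auto simp: continuous_family_def)
  then show "uniform_limit K (\<lambda>y t. B (F y t)) (\<lambda>t. B (F x t)) (atin X x)"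
    by (simp add: o_def)
qed

text \<open>Products preserve uniform limits when both limits are bounded, which compactness of
  \<open>K\<close> provides.\<close>

lemma continuous_family_scaleR:
  fixes F :: "'x \<Rightarrow> 'a::topological_space \<Rightarrow> 'b::real_normed_vector"
  assumes "continuous_family X K f" "continuous_family X K F" "compact K"
  shows "continuous_family X K (\<lambda>x t. f x t *\<^sub>R F x t)"
  unfolding continuous_family_def
proof (intro ballI conjI)
  fix x assume "x \<in> topspace X"
  then have *: "continuous_on K (f x)" "uniform_limit K f (f x) (atin X x)"
    "continuous_on K (F x)" "uniform_limit K F (F x) (atin X x)"
    using assms(1,2) by (simp_all add: continuous_family_def)
  then show "continuous_on K (\<lambda>t. f x t *\<^sub>R F x t)"
    by (intro continuous_on_scaleR)
  have "bounded (f x ` K)" "bounded (F x ` K)"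
    using *(1,3) assms(3) by (simp_all add: compact_imp_bounded compact_continuous_image)
  with *(2,4) show "uniform_limit K (\<lambda>x t. f x t *\<^sub>R F x t) (\<lambda>t. f x t *\<^sub>R F x t) (atin X x)"
    by (intro bounded_bilinear.bounded_uniform_limit[OF bounded_bilinear_scaleR])
qed

lemma continuous_family_add:
  fixes F :: "'x \<Rightarrow> 'a::topological_space \<Rightarrow> 'b::real_normed_vector"
  assumes "continuous_family X K F" "continuous_family X K G"
  shows "continuous_family X K (\<lambda>x t. F x t + G x t)"
  using assms unfolding continuous_family_def
  by (simp add: continuous_on_add uniform_limit_add)

lemma continuous_family_bounded_linear:
  assumes "bounded_linear h" "continuous_family X K F"
  shows "continuous_family X K (\<lambda>x t. h (F x t))"
  using assms unfolding continuous_family_def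
  by (simp add: bounded_linear.continuous_on bounded_linear.uniform_limit)

lemma continuous_family_reparametrize:
  assumes "continuous_family X K F" "continuous_on K' h" "h ` K' \<subseteq> K"
  shows "continuous_family X K' (\<lambda>x t. F x (h t))"
  unfolding continuous_family_def
proof (intro ballI conjI)
  fix x assume x: "x \<in> topspace X"
  show "continuous_on K' (\<lambda>t. F x (h t))"
    by (rule continuous_on_compose2[of K "F x"]) (use assms x in \<open>auto simp: continuous_family_def\<close>)
  show "uniform_limit K' (\<lambda>x t. F x (h t)) (\<lambda>t. F x (h t)) (atin X x)"
    by (rule uniform_limit_compose'[where f = F and A = K]) (use assms x in \<open>auto simp: continuous_family_def\<close>)
qed

lemma continuous_family_vec_lambda:
  fixes F :: "'x \<Rightarrow> 'a::topological_space \<Rightarrow> 'n::finite \<Rightarrow> 'b::metric_space"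
  assumes "\<And>i. continuous_family X K (\<lambda>x t. F x t i)"
  shows "continuous_family X K (\<lambda>x t. \<chi> i. F x t i)"
  using assms unfolding continuous_family_def
  by (simp add: continuous_on_vec_lambda uniform_limit_vec_lambda)

text \<open>Uniform closeness on \<open>T\<close> is the same as on \<open>S\<close> because
  \<open>q\<close> is onto; continuity of the single maps comes from the quotient property.\<close>

lemma continuous_family_quotient:
  fixes q :: "'a::t2_space \<Rightarrow> 'b::t2_space"
  assumes q: "continuous_on S q" "compact S" "q ` S = T"
    and F: "continuous_family X S (\<lambda>x s. F x (q s))"
  shows "continuous_family X T F"
  unfolding continuous_family_def
proof (intro ballI conjI)
  fix x assume x: "x \<in> topspace X"
  show "continuous_on T (F x)"
    by (rule continuous_on_compact_quotient[of S q]) (use q F x in \<open>auto simp: continuous_family_def\<close>)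
  have "uniform_limit S (\<lambda>x s. F x (q s)) (\<lambda>s. F x (q s)) (atin X x)"
    using F x by (simp add: continuous_family_def)
  then show "uniform_limit T F (F x) (atin X x)"
    unfolding uniform_limit_iff q(3)[symmetric] by simp
qed

section \<open>Maps induced on path components\<close>

text \<open>The image of a path component is path connected, so it lies in the component of
  \<open>f x\<close>. Components are equivalence classes, so no other one contains the image and the
  definite description is justified.\<close>

lemma pi0_map_eq:
  assumes f: "continuous_map X Y f" and P: "P \<in> path_components_of X" and x: "x \<in> P"
  shows "pi0_map X Y f P = Collect (path_component_of Y (f x))"
  unfolding pi0_map_def
proof (rule the_equality)
  have xX: "x \<in> topspace X"
    using path_components_of_subset[OF P] x by auto
  then have fx: "f x \<in> topspace Y"
    using f by (auto simp: continuous_map_def)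
  have "path_connectedin Y (f ` P)"
    using f P by (meson path_connectedin_continuous_map_image path_connectedin_path_components_of)
  then show "Collect (path_component_of Y (f x)) \<in> path_components_of Y \<and>
      f ` P \<subseteq> Collect (path_component_of Y (f x))"
    using x fx by (simp add: path_component_in_path_components_of path_component_of_maximal)
  fix Q assume Q: "Q \<in> path_components_of Y \<and> f ` P \<subseteq> Q"
  then obtain y where y: "Q = Collect (path_component_of Y y)"
    by (auto simp: path_components_of_def)
  then have "path_component_of Y y (f x)"
    using Q x by auto
  then show "Q = Collect (path_component_of Y (f x))"
    unfolding y by (metis path_component_of_equiv)
qed

text \<open>Once a point \<open>x\<close> of \<open>P\<close> is chosen, both sides are the
  component of \<open>g (f x)\<close>.\<close>

lemma pi0_map_compose:
  assumes f: "continuous_map X Y f" and g: "continuous_map Y Z g" and P: "P \<in> path_components_of X"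
  shows "pi0_map Y Z g (pi0_map X Y f P) = pi0_map X Z (g \<circ> f) P"
proof -
  obtain x where x: "x \<in> P"
    using nonempty_path_components_of[OF P] by blast
  then have fx: "f x \<in> topspace Y"
    using f path_components_of_subset[OF P] by (auto simp: continuous_map_def)
  then have "pi0_map Y Z g (Collect (path_component_of Y (f x))) =
      Collect (path_component_of Z (g (f x)))"
    by (intro pi0_map_eq[OF g]) (auto simp: path_component_in_path_components_of path_component_of_refl)
  then show ?thesis
    using pi0_map_eq[OF f P x] pi0_map_eq[OF continuous_map_compose[OF f g] P x] by simp
qed

section \<open>Families of loops\<close>

text \<open>Composition with \<open>frac\<close> is the 1-periodic extension. On
  \<open>{m..m+1}\<close> with integer \<open>m\<close> it is a translate of \<open>f\<close>, and
  at the integers the one-sided derivatives are \<open>g 1\<close> from the left and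
  \<open>g 0\<close> from the right.\<close>

lemma has_vector_derivative_frac:
  fixes f g :: "real \<Rightarrow> 'a::real_normed_vector"
  assumes f: "\<And>t. t \<in> {0..1} \<Longrightarrow> (f has_vector_derivative g t) (at t within {0..1})"
    and ends: "f 0 = f 1" "g 0 = g 1"
  shows "((\<lambda>t. f (frac t)) has_vector_derivative g (frac t)) (at t)"
proof -
  have piece: "((\<lambda>t. f (frac t)) has_vector_derivative g (frac s)) (at s within {m..m+1})"
    if "m \<in> \<int>" "s \<in> {m..m+1}" for m s :: real
  proof -
    \<comment> \<open>At the right end \<open>u = m + 1\<close> the two arguments are 0 and 1, and
      \<open>h 0 = h 1\<close> makes up for the difference. This is applied to \<open>f\<close> and
      to \<open>g\<close>.\<close>
    have eq: "h (frac u) = h (u - m)" if "u \<in> {m..m+1}" "h 0 = h 1" for u and h :: "real \<Rightarrow> 'a"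
    proof (cases "u = m + 1")
      case True
      then have "frac u = 0"
        using \<open>m \<in> \<int>\<close> by simp
      then have "h (frac u) = h 0"
        by (rule arg_cong)
      then show ?thesis
        using True that(2) by simp
    next
      case False
      then have "frac u = u - m"
        using \<open>m \<in> \<int>\<close> that(1) by (intro frac_unique_iff[THEN iffD2]) auto
      then show ?thesis
        by simp
    qed
    have "((\<lambda>u. u - m) has_vector_derivative 1) (at s within {m..m+1})"
      by (auto intro!: derivative_eq_intros)
    moreover have "(f has_vector_derivative g (s - m)) (at (s - m) within (\<lambda>u. u - m) ` {m..m+1})"
      using that(2) by (intro has_vector_derivative_within_subset[OF f]) auto
    ultimately have "(f \<circ> (\<lambda>u. u - m) has_vector_derivative 1 *\<^sub>R g (s - m)) (at s within {m..m+1})"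
      by (rule vector_diff_chain_within)
    then have "((\<lambda>u. f (u - m)) has_vector_derivative g (frac s)) (at s within {m..m+1})"
      using eq[where h = g, OF that(2) ends(2)] by (simp add: o_def)
    then show ?thesis
      by (rule has_vector_derivative_transform[OF that(2), rotated]) (simp add: eq[where h = f, OF _ ends(1)])
  qed
  define m :: real where "m = of_int \<lfloor>t\<rfloor>"
  have m: "m \<in> \<int>" "m \<le> t" "t < m + 1"
    unfolding m_def by (simp, linarith+)
  show ?thesis
  proof (cases "t = m")
    case False
    then have "t \<in> interior {m..m+1}"
      using m by simp
    then have "at t within {m..m+1} = at t"
      by (rule at_within_interior)
    moreover have "t \<in> {m..m+1}"
      using m by simp
    ultimately show ?thesis
      using piece[OF m(1), of t] by simp
  next
    case True
    \<comment> \<open>At an integer the one-sided derivatives from the two adjacent intervals have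
      the same value and combine to a two-sided one.\<close>
    have "((\<lambda>t. f (frac t)) has_vector_derivative g (frac t)) (at t within {t-1..t})"
      "((\<lambda>t. f (frac t)) has_vector_derivative g (frac t)) (at t within {t..t+1})"
      using piece[of t t] piece[of "t - 1" t] m(1) True by auto
    then have "((\<lambda>t. f (frac t)) has_vector_derivative g (frac t)) (at t within {t-1..t} \<union> {t..t+1})"
      unfolding has_vector_derivative_def has_derivative_within
      by (simp add: at_within_union filterlim_sup)
    moreover have "at t within {t-1..t} \<union> {t..t+1} = at t"
      by (rule at_within_interior, rule interiorI[of "{t-1<..<t+1}"]) auto
    ultimately show ?thesis
      by simp
  qed
qed

section \<open>Calculus of families of loops\<close>

definition loop_family :: "'x topology \<Rightarrow> ('x \<Rightarrow> real \<Rightarrow> 'a::real_normed_vector) \<Rightarrow> bool" where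
  "loop_family X F \<longleftrightarrow> continuous_family X {0..1} F \<and> (\<forall>x\<in>topspace X. F x 0 = F x 1)"

definition deriv_family ::
  "'x topology \<Rightarrow> ('x \<Rightarrow> real \<Rightarrow> 'a::real_normed_vector) \<Rightarrow> ('x \<Rightarrow> real \<Rightarrow> 'a) \<Rightarrow> bool" where
  "deriv_family X F G \<longleftrightarrow>
     (\<forall>x\<in>topspace X. \<forall>t\<in>{0..1}. (F x has_vector_derivative G x t) (at t within {0..1}))"

text \<open>
  Families of loops on the unit interval whose first \<open>k\<close> derivatives exist, close up and depend
  continuously on the parameter. The derivative is quantified existentially, so that stability under
  products and compositions is proved by induction without a formula for higher derivatives.
\<close>

primrec Ck_loops :: "'x topology \<Rightarrow> nat \<Rightarrow> ('x \<Rightarrow> real \<Rightarrow> 'a::real_normed_vector) \<Rightarrow> bool" where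
  "Ck_loops X 0 F \<longleftrightarrow> loop_family X F"
| "Ck_loops X (Suc k) F \<longleftrightarrow> loop_family X F \<and> (\<exists>G. deriv_family X F G \<and> Ck_loops X k G)"

lemma Ck_loops_imp_loop_family: "Ck_loops X k F \<Longrightarrow> loop_family X F"
  by (cases k) auto

text \<open>This serves the product rule, where the factor that is not differentiated has to be
  taken at order \<open>k\<close> instead of \<open>Suc k\<close>.\<close>

lemma Ck_loops_SucD: "Ck_loops X (Suc k) F \<Longrightarrow> Ck_loops X k F"
proof (induction k arbitrary: F)
  case (Suc k)
  then obtain G where G: "loop_family X F" "deriv_family X F G" "Ck_loops X (Suc k) G"
    unfolding Ck_loops.simps(2)[of X "Suc k"] by blast
  with Suc.IH[OF G(3)] show ?case
    unfolding Ck_loops.simps(2)[of X k F] by blast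
qed simp

lemma Ck_loops_add:
  "Ck_loops X k F \<Longrightarrow> Ck_loops X k G \<Longrightarrow> Ck_loops X k (\<lambda>x t. F x t + G x t)"
proof (induction k arbitrary: F G)
  case 0
  then show ?case
    by (simp add: loop_family_def continuous_family_add)
next
  case (Suc k)
  then obtain F' G' where *: "deriv_family X F F'" "deriv_family X G G'" "Ck_loops X k F'" "Ck_loops X k G'"
    by auto
  have "loop_family X (\<lambda>x t. F x t + G x t)"
    using Suc.prems by (simp add: loop_family_def continuous_family_add)
  moreover have "deriv_family X (\<lambda>x t. F x t + G x t) (\<lambda>x t. F' x t + G' x t)"
    using *(1,2) by (auto simp: deriv_family_def intro: has_vector_derivative_add)
  ultimately show ?case
    using Suc.IH[OF *(3,4)] by auto
qed

lemma Ck_loops_zero: "Ck_loops X k (\<lambda>x t. 0)"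
proof (induction k)
  case 0
  then show ?case
    by (simp add: loop_family_def continuous_family_def uniform_limit_iff)
next
  case (Suc k)
  then have "loop_family X (\<lambda>x t. 0 :: 'b)"
    by (rule Ck_loops_imp_loop_family)
  with Suc show ?case
    by (auto simp: deriv_family_def intro!: exI[of _ "\<lambda>x t. 0"])
qed

lemma Ck_loops_sum:
  "finite I \<Longrightarrow> (\<And>i. i \<in> I \<Longrightarrow> Ck_loops X k (F i)) \<Longrightarrow> Ck_loops X k (\<lambda>x t. \<Sum>i\<in>I. F i x t)"
  by (induction I rule: finite_induct) (auto simp: Ck_loops_zero Ck_loops_add)

lemma Ck_loops_bounded_linear:
  assumes "bounded_linear h"
  shows "Ck_loops X k F \<Longrightarrow> Ck_loops X k (\<lambda>x t. h (F x t))"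
proof (induction k arbitrary: F)
  case 0
  then show ?case
    using assms by (simp add: loop_family_def continuous_family_bounded_linear)
next
  case (Suc k)
  then obtain G where *: "deriv_family X F G" "Ck_loops X k G"
    by auto
  have "loop_family X (\<lambda>x t. h (F x t))"
    using Suc.prems assms by (simp add: loop_family_def continuous_family_bounded_linear)
  moreover have "deriv_family X (\<lambda>x t. h (F x t)) (\<lambda>x t. h (G x t))"
    using *(1) assms by (auto simp: deriv_family_def intro: bounded_linear.has_vector_derivative)
  ultimately show ?case
    using Suc.IH[OF *(2)] by auto
qed

text \<open>The product rule writes the derivative as a sum of two products of order
  \<open>k\<close>, to which the induction hypothesis applies.\<close>

lemma Ck_loops_scaleR:
  "Ck_loops X k f \<Longrightarrow> Ck_loops X k F \<Longrightarrow> Ck_loops X k (\<lambda>x t. f x t *\<^sub>R F x t)"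
proof (induction k arbitrary: f F)
  case 0
  then show ?case
    by (simp add: loop_family_def continuous_family_scaleR)
next
  case (Suc k)
  then obtain g G where *: "deriv_family X f g" "deriv_family X F G" "Ck_loops X k g" "Ck_loops X k G"
    by auto
  have "loop_family X (\<lambda>x t. f x t *\<^sub>R F x t)"
    using Suc.prems by (simp add: loop_family_def continuous_family_scaleR)
  moreover have "deriv_family X (\<lambda>x t. f x t *\<^sub>R F x t) (\<lambda>x t. f x t *\<^sub>R G x t + g x t *\<^sub>R F x t)"
    using *(1,2) unfolding deriv_family_def has_real_derivative_iff_has_vector_derivative[symmetric]
    by (auto intro: has_vector_derivative_scaleR)
  moreover have "Ck_loops X k (\<lambda>x t. f x t *\<^sub>R G x t + g x t *\<^sub>R F x t)"
    using Suc.prems[THEN Ck_loops_SucD] *(3,4) by (intro Ck_loops_add Suc.IH)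
  ultimately show ?case
    by auto
qed

section \<open>Derivatives of periodic extensions\<close>

text \<open>\<open>iter_deriv\<close> adds derivatives on the outside, whereas inductions along
  \<open>Ck_loops\<close> take the innermost one first.\<close>

lemma iter_deriv_Suc_shift: "iter_deriv J (Suc k) c = iter_deriv J k (iter_deriv J 1 c)"
  by (induction k) auto

text \<open>As \<open>F\<close> and \<open>G\<close> both close up, the two-sided derivative of the
  extension of \<open>F\<close> is the extension of \<open>G\<close>. One order of differentiation
  thus moves into the family.\<close>

lemma iter_deriv_frac_Suc:
  assumes F: "loop_family X F" "deriv_family X F G" "loop_family X G" and x: "x \<in> topspace X"
  shows "iter_deriv UNIV (Suc k) (\<lambda>t. F x (frac t)) = iter_deriv UNIV k (\<lambda>t. G x (frac t))"
proof -
  have "iter_deriv UNIV 1 (\<lambda>t. F x (frac t)) = (\<lambda>t. G x (frac t))"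
    using assms by (auto simp: loop_family_def deriv_family_def
        intro!: vector_derivative_at has_vector_derivative_frac)
  then show ?thesis
    unfolding iter_deriv_Suc_shift by simp
qed

lemma continuous_family_iter_deriv_frac:
  "Ck_loops X k F \<Longrightarrow> continuous_family X {0..1} (\<lambda>x. iter_deriv UNIV k (\<lambda>t. F x (frac t)))"
proof (induction k arbitrary: F)
  case 0
  then have F: "continuous_family X {0..1} F" "\<And>x. x \<in> topspace X \<Longrightarrow> F x 0 = F x 1"
    by (auto simp: loop_family_def)
  \<comment> \<open>At \<open>t = 1\<close> the value of \<open>frac\<close> is 0, and the equality
    is the closing condition.\<close>
  have "F x t = F x (frac t)" if "x \<in> topspace X" "t \<in> {0..1}" for x t
    using that F(2) by (cases "t = 1") (auto simp: frac_eq[THEN iffD2])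
  then have "continuous_family X {0..1} F \<longleftrightarrow> continuous_family X {0..1} (\<lambda>x t. F x (frac t))"
    by (rule continuous_family_cong)
  with F(1) show ?case
    by simp
next
  case (Suc k)
  then obtain G where F: "loop_family X F" "deriv_family X F G" "Ck_loops X k G"
    by auto
  have "continuous_family X {0..1} (\<lambda>x. iter_deriv UNIV (Suc k) (\<lambda>t. F x (frac t))) \<longleftrightarrow>
      continuous_family X {0..1} (\<lambda>x. iter_deriv UNIV k (\<lambda>t. G x (frac t)))"
    by (rule continuous_family_cong)
      (simp only: iter_deriv_frac_Suc[OF F(1,2) Ck_loops_imp_loop_family[OF F(3)]])
  with Suc.IH[OF F(3)] show ?case
    by (simp only:)
qed

text \<open>One order more than \<open>k\<close> is assumed, since the \<open>k\<close>-th
  derivative must itself be differentiable, also at the integers.\<close>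

lemma differentiable_iter_deriv_frac:
  "Ck_loops X (Suc k) F \<Longrightarrow> x \<in> topspace X \<Longrightarrow>
     iter_deriv UNIV k (\<lambda>t. F x (frac t)) differentiable_on UNIV"
proof (induction k arbitrary: F)
  case 0
  then obtain G where F: "loop_family X F" "deriv_family X F G" "loop_family X G"
    by auto
  have "((\<lambda>t. F x (frac t)) has_vector_derivative G x (frac t)) (at t)" for t
    using F 0 by (intro has_vector_derivative_frac) (auto simp: loop_family_def deriv_family_def)
  then show ?case
    by (auto simp: differentiable_on_def intro: differentiableI_vector)
next
  case (Suc k)
  then obtain G where F: "loop_family X F" "deriv_family X F G" "Ck_loops X (Suc k) G"
    by auto
  show ?case
    using Suc.IH[OF F(3)] Suc.prems iter_deriv_frac_Suc[OF F(1,2) Ck_loops_imp_loop_family[OF F(3)]]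
    by (simp del: Ck_loops.simps iter_deriv.simps)
qed

section \<open>Bending the cylinder\<close>

lemma smooth_on_imp_continuous_on: "smooth_on S f \<Longrightarrow> continuous_on S f"
  unfolding smooth_on_def using Ck_on.simps(1) by blast

lemma smooth_on_frechet_derivative:
  "smooth_on S f \<Longrightarrow> smooth_on S (\<lambda>x. frechet_derivative f (at x) v)"
  unfolding smooth_on_def using Ck_on.simps(2) by blast

lemma smooth_on_has_derivative:
  assumes "smooth_on S f" "open S" "x \<in> S"
  shows "(f has_derivative frechet_derivative f (at x)) (at x)"
proof -
  have "f differentiable_on S"
    using assms(1) unfolding smooth_on_def using Ck_on.simps(2)[of 0 S f] by blast
  then show ?thesis
    using assms(2,3) by (simp add: differentiable_on_eq_differentiable_at frechet_derivative_works)
qed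

text \<open>It lets partial derivatives of \<open>B\<close> replace \<open>B\<close> in an
  induction. Over the open disk it is the chain rule for the translation by
  \<open>(0, 1)\<close>.\<close>

lemma frechet_derivative_periodic:
  fixes B :: "'a::real_normed_vector \<times> real \<Rightarrow> 'b::real_normed_vector"
  assumes U: "open U" "cball 0 1 \<times> UNIV \<subseteq> U" and B: "smooth_on U B"
    and per: "\<And>x z. x \<in> cball 0 1 \<Longrightarrow> B (x, z + 1) = B (x, z)" and x: "x \<in> cball 0 1"
  shows "frechet_derivative B (at (x, z + 1)) v = frechet_derivative B (at (x, z)) v"
proof -
  have D: "(B has_derivative frechet_derivative B (at (y, w))) (at (y, w))" if "y \<in> cball 0 1" for y w
    using U that by (intro smooth_on_has_derivative[OF B U(1)]) auto
  have inner: "frechet_derivative B (at (y, z + 1)) v = frechet_derivative B (at (y, z)) v"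
    if y: "y \<in> ball 0 1" for y
  proof -
    have "((\<lambda>p. p + (0, 1)) has_derivative (\<lambda>p. p)) (at (y, z))"
      by (auto intro!: derivative_eq_intros)
    moreover have "(B has_derivative frechet_derivative B (at (y, z + 1))) (at ((y, z) + (0, 1)))"
      using D[of y "z + 1"] y by (simp add: less_imp_le)
    ultimately have "((\<lambda>p. B (p + (0, 1))) has_derivative frechet_derivative B (at (y, z + 1))) (at (y, z))"
      by (rule has_derivative_compose)
    then have "(B has_derivative frechet_derivative B (at (y, z + 1))) (at (y, z))"
      by (rule has_derivative_transform_within_open[of _ _ _ _ "ball 0 1 \<times> UNIV"])
        (use y per in \<open>auto simp: open_Times less_imp_le\<close>)
    then show ?thesis
      by (metis frechet_derivative_at)
  qed
  have cont: "continuous_on (cball 0 1) (\<lambda>y. frechet_derivative B (at (y, w)) v)" for w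
    using U by (intro continuous_on_compose2[OF smooth_on_imp_continuous_on
          [OF smooth_on_frechet_derivative[OF B]]] continuous_intros) auto
  \<comment> \<open>\<open>B\<close> need not be periodic outside the closed disk, so boundary points are reached by continuity.\<close>
  let ?h = "\<lambda>y. frechet_derivative B (at (y, z + 1)) v - frechet_derivative B (at (y, z)) v"
  have "?h x = 0"
  proof (rule continuous_constant_on_closure[where S = "ball 0 1" and f = ?h])
    show "continuous_on (closure (ball 0 1)) ?h"
      using cont by (simp add: continuous_on_diff)
    show "x \<in> closure (ball 0 1)"
      using x by simp
  qed (use inner in simp)
  then show ?thesis
    by simp
qed

lemma compact_cylinder: "compact cylinder"
  by (simp add: cylinder_def compact_Times)

text \<open>Along a curve the direction \<open>v\<close> varies with the parameter. Expanding it in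
  the basis leaves derivatives in fixed directions with scalar factors, a form covered by the rules
  for sums and products of loops.\<close>

lemma frechet_derivative_sum_Basis:
  fixes f :: "'a::euclidean_space \<Rightarrow> 'b::real_normed_vector"
  assumes "(f has_derivative frechet_derivative f (at x)) (at x)"
  shows "frechet_derivative f (at x) v = (\<Sum>e\<in>Basis. (v \<bullet> e) *\<^sub>R frechet_derivative f (at x) e)"
proof -
  have "linear (frechet_derivative f (at x))"
    using assms by (rule has_derivative_linear)
  then have "frechet_derivative f (at x) (\<Sum>e\<in>Basis. (v \<bullet> e) *\<^sub>R e) =
      (\<Sum>e\<in>Basis. (v \<bullet> e) *\<^sub>R frechet_derivative f (at x) e)"
    by (simp add: linear_sum linear_scale)
  then show ?thesis
    by (simp add: euclidean_representation)
qed

text \<open>\<open>F\<close> does not close up itself, its ends differing by 1 in height; the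
  periodicity of \<open>B\<close> closes the composite. The induction runs over all smooth periodic
  \<open>B\<close>, since the chain rule brings in partial derivatives.\<close>

lemma Ck_loops_compose_periodic:
  fixes B :: "(real^2) \<times> real \<Rightarrow> 'b::real_normed_vector"
  assumes U: "open U" "cball 0 1 \<times> UNIV \<subseteq> U"
    and F: "continuous_family X {0..1} F" "\<And>x t. x \<in> topspace X \<Longrightarrow> t \<in> {0..1} \<Longrightarrow> F x t \<in> cylinder"
    and ends: "\<And>x. x \<in> topspace X \<Longrightarrow> F x 0 = (p x, 0) \<and> F x 1 = (p x, 1)"
    and G: "deriv_family X F G" "\<And>k. Ck_loops X k G"
  shows "smooth_on U B \<Longrightarrow> (\<And>x z. x \<in> cball 0 1 \<Longrightarrow> B (x, z + 1) = B (x, z)) \<Longrightarrow>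
    Ck_loops X k (\<lambda>x t. B (F x t))"
proof (induction k arbitrary: B)
  case (0 B)
  have cyl: "cylinder \<subseteq> U"
    using U(2) by (auto simp: cylinder_def)
  have "continuous_family X {0..1} (\<lambda>x t. B (F x t))"
    using F continuous_on_subset[OF smooth_on_imp_continuous_on[OF 0(1)] cyl] compact_cylinder
    by (rule continuous_family_compose)
  moreover have "B (F x 0) = B (F x 1)" if "x \<in> topspace X" for x
    using 0(2)[of "p x" 0] ends[OF that] F(2)[OF that, of 0] by (simp add: cylinder_def)
  ultimately show ?case
    by (simp add: loop_family_def)
next
  case (Suc k B)
  let ?D = "\<lambda>e q. frechet_derivative B (at q) e"
  let ?G = "\<lambda>x t. \<Sum>e\<in>Basis. (G x t \<bullet> e) *\<^sub>R ?D e (F x t)"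
  have "Ck_loops X k (\<lambda>x t. ?D e (F x t))" for e
    using Suc.prems U by (intro Suc.IH smooth_on_frechet_derivative frechet_derivative_periodic)
  then have "Ck_loops X k ?G"
    by (intro Ck_loops_sum Ck_loops_scaleR Ck_loops_bounded_linear[OF bounded_linear_inner_left] G) auto
  moreover have "deriv_family X (\<lambda>x t. B (F x t)) ?G"
    unfolding deriv_family_def
  proof (intro ballI)
    fix x and t :: real assume x: "x \<in> topspace X" and t: "t \<in> {0..1}"
    have "F x t \<in> U"
      using F(2)[OF x t] U by (auto simp: cylinder_def)
    then have D: "(B has_derivative (\<lambda>e. ?D e (F x t))) (at (F x t))"
      using smooth_on_has_derivative[OF Suc.prems(1) U(1)] by simp
    have "((B \<circ> F x) has_vector_derivative ?D (G x t) (F x t)) (at t within {0..1})"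
      using G(1) x t D by (intro vector_derivative_diff_chain_within)
        (auto simp: deriv_family_def intro: has_derivative_at_withinI)
    then show "((\<lambda>t. B (F x t)) has_vector_derivative ?G x t) (at t within {0..1})"
      unfolding o_def frechet_derivative_sum_Basis[OF D, of "G x t"] .
  qed
  moreover have "loop_family X (\<lambda>x t. B (F x t))"
    using Suc.IH[OF Suc.prems] by (rule Ck_loops_imp_loop_family)
  ultimately show ?case
    unfolding Ck_loops.simps by blast
qed

section \<open>The circle and the torus as quotients\<close>

lemma wrap_in_circle: "wrap t \<in> circle"
  by (simp add: wrap_def circle_def)

lemma wrap_unwrap: "x \<in> circle \<Longrightarrow> wrap (unwrap x) = x"
  using Arg2pi_eq[of x] by (simp add: circle_def wrap_def unwrap_def cis_conv_exp)

lemma unwrap_bounds: "0 \<le> unwrap x" "unwrap x < 1"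
  using Arg2pi_ge_0[of x] Arg2pi_lt_2pi[of x] by (simp_all add: unwrap_def)

text \<open>\<open>Arg2pi\<close> takes values from 0 inclusive to \<open>2 * pi\<close> exclusive,
  so the integer part of \<open>t\<close> is lost. In this way closed links, read along
  \<open>wrap\<close>, become periodic extensions.\<close>

lemma unwrap_wrap: "unwrap (wrap t) = frac t"
proof -
  have "wrap t = cis (2 * pi * frac t + 2 * pi * of_int \<lfloor>t\<rfloor>)"
    unfolding wrap_def frac_def by (simp add: algebra_simps)
  also have "\<dots> = cis (2 * pi * frac t)"
    by (simp add: cis_mult[symmetric])
  finally have "Arg2pi (wrap t) = 2 * pi * frac t"
    using frac_lt_1[of t] by (intro Arg2pi_unique[of 1]) (auto simp: cis_conv_exp)
  then show ?thesis
    by (simp add: unwrap_def)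
qed

lemma wrap_image: "wrap ` {0..1} = circle"
proof (intro equalityI subsetI)
  fix x assume "x \<in> circle"
  then show "x \<in> wrap ` {0..1}"
    using wrap_unwrap[of x] unwrap_bounds[of x] by (intro image_eqI[of _ _ "unwrap x"]) auto
qed (auto simp: wrap_in_circle)

lemma wrap_torus_unwrap_torus: "x \<in> torus \<Longrightarrow> wrap_torus (unwrap_torus x) = x"
  by (simp add: wrap_torus_def unwrap_torus_def torus_def wrap_unwrap vec_eq_iff)

lemma unwrap_torus_in_unit_cube: "unwrap_torus x \<in> unit_cube"
  using unwrap_bounds by (auto simp: unwrap_torus_def unit_cube_def intro: less_imp_le)

lemma wrap_torus_in_torus: "wrap_torus t \<in> torus"
  by (simp add: wrap_torus_def torus_def wrap_in_circle)

lemma wrap_torus_image: "wrap_torus ` unit_cube = torus"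
proof (intro equalityI subsetI)
  fix x :: "complex^'n" assume "x \<in> torus"
  then show "x \<in> wrap_torus ` unit_cube"
    using wrap_torus_unwrap_torus unwrap_torus_in_unit_cube by (metis image_eqI)
qed (auto simp: wrap_torus_in_torus)

lemma continuous_on_wrap: "continuous_on S wrap"
  unfolding wrap_def by (intro continuous_intros)

lemma continuous_on_wrap_torus: "continuous_on S wrap_torus"
  unfolding wrap_torus_def wrap_def by (intro continuous_on_vec_lambda continuous_intros)

section \<open>The closure map\<close>

lemma bends_cylinderE:
  assumes "bends_cylinder b"
  obtains U B where "open U" "cball 0 1 \<times> UNIV \<subseteq> U" "smooth_on U B"
    "\<forall>p\<in>cylinder. inj (frechet_derivative B (at p))"
    "\<forall>x\<in>cball 0 1. \<forall>z. B (x, z + 1) = B (x, z)" "\<forall>p\<in>cylinder. b p = B p"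
proof -
  from assms obtain U B where *: "open U" "cball 0 1 \<times> UNIV \<subseteq> U" "smooth_on U B"
    "\<forall>p \<in> cball 0 1 \<times> UNIV. inj (frechet_derivative B (at p))"
    "\<forall>x \<in> cball 0 1. \<forall>z. B (x, z + 1) = B (x, z)" "\<forall>p \<in> cylinder. b p = B p"
    unfolding bends_cylinder_def by (elim conjE exE)
  have "cylinder \<subseteq> cball 0 1 \<times> UNIV"
    by (auto simp: cylinder_def)
  with * show ?thesis
    by (intro that[of U B]) auto
qed

lemma bends_cylinder_eq_iff:
  assumes "bends_cylinder b" "p \<in> cylinder" "q \<in> cylinder"
  shows "b p = b q \<longleftrightarrow> p = q \<or> (fst p = fst q \<and> {snd p, snd q} = {0, 1})"
  using assms unfolding bends_cylinder_def by blast

lemma bends_cylinder_ends: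
  assumes "bends_cylinder b" "x \<in> cball 0 1"
  shows "b (x, 0) = b (x, 1)"
  using bends_cylinder_eq_iff[OF assms(1), of "(x, 0)" "(x, 1)"] assms(2) by (simp add: cylinder_def)

lemma continuous_on_bends_cylinder:
  assumes "bends_cylinder b"
  shows "continuous_on cylinder b"
proof -
  obtain U B where *: "cball 0 1 \<times> UNIV \<subseteq> U" "smooth_on U B" "\<forall>p\<in>cylinder. b p = B p"
    by (rule bends_cylinderE[OF assms]) (rule that)
  have "cylinder \<subseteq> U"
    using *(1) by (auto simp: cylinder_def)
  then have "continuous_on cylinder B"
    using smooth_on_imp_continuous_on[OF *(2)] continuous_on_subset by blast
  then show ?thesis
    using *(3) by (simp cong: continuous_on_cong)
qed

section \<open>Jets of string links and links\<close>

lemma continuous_map_slink_jets: "continuous_map (slink_space a) jet_topology (jets {0..1})"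
  unfolding slink_space_def
  using continuous_map_pullback[OF continuous_map_id, of "slink a" "jets {0..1}" jet_topology] by simp

text \<open>The topology of string links is pulled back along \<open>jets\<close>, so it makes every
  derivative of every strand depend continuously on the string link.\<close>

lemma continuous_family_slink:
  "continuous_family (slink_space a) {0..1} (\<lambda>\<sigma>. iter_deriv {0..1} k (\<sigma> i))"
proof -
  have "continuous_map (slink_space a) (uniform_topology {0..1}) (\<lambda>\<sigma>. jets {0..1} \<sigma> (k, i))"
    using continuous_map_slink_jets[of a]
    unfolding jet_topology_def continuous_map_componentwise_UNIV by blast
  then show ?thesis
    by (simp add: continuous_family_iff jets_def)
qed

lemma continuous_family_link:
  "continuous_family (link_space a) {0..1} (\<lambda>L t. L i (wrap t))"
proof -
  have "continuous_map (link_space a) jet_topology (\<lambda>L. jets UNIV (\<lambda>i. L i \<circ> wrap))"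
    unfolding link_space_def
    using continuous_map_pullback[OF continuous_map_id, of "link a" "\<lambda>L. jets UNIV (\<lambda>i. L i \<circ> wrap)" jet_topology]
    by (simp add: o_def)
  then have "continuous_map (link_space a) (uniform_topology {0..1})
      (\<lambda>L. jets UNIV (\<lambda>i. L i \<circ> wrap) (0, i))"
    unfolding jet_topology_def continuous_map_componentwise_UNIV by blast
  then show ?thesis
    by (simp add: continuous_family_iff jets_def o_def)
qed

lemma slinkD:
  assumes "\<sigma> \<in> slink a"
  shows "t \<in> {0..1} \<Longrightarrow> \<sigma> i t \<in> cylinder"
    and "t \<in> {0<..<1} \<Longrightarrow> \<sigma> i t \<in> interior cylinder"
    and "smooth_immersed_curve {0..1} (\<sigma> i)"
    and "\<sigma> i 0 = (a $ i, 0)" "\<sigma> i 1 = (a $ i, 1)"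
    and "k \<ge> 1 \<Longrightarrow> iter_deriv {0..1} k (\<sigma> i) 0 = iter_deriv {0..1} k (\<sigma> i) 1"
    and "i \<noteq> j \<Longrightarrow> s \<in> {0..1} \<Longrightarrow> t \<in> {0..1} \<Longrightarrow> \<sigma> i s \<noteq> \<sigma> j t"
proof -
  have \<sigma>: "\<forall>i. \<sigma> i ` {0..1} \<subseteq> cylinder" "\<forall>i. \<sigma> i ` {0<..<1} \<subseteq> interior cylinder"
    "\<forall>i. smooth_immersed_curve {0..1} (\<sigma> i)" "\<forall>i. \<sigma> i 0 = (a $ i, 0) \<and> \<sigma> i 1 = (a $ i, 1)"
    "\<forall>i. meets_ends_orthogonally (\<sigma> i)"
    "\<forall>i j. i \<noteq> j \<longrightarrow> \<sigma> i ` {0..1} \<inter> \<sigma> j ` {0..1} = {}"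
    using assms unfolding slink_def by simp_all
  show "t \<in> {0..1} \<Longrightarrow> \<sigma> i t \<in> cylinder" "t \<in> {0<..<1} \<Longrightarrow> \<sigma> i t \<in> interior cylinder"
    using \<sigma>(1,2) by blast+
  show "smooth_immersed_curve {0..1} (\<sigma> i)" "\<sigma> i 0 = (a $ i, 0)" "\<sigma> i 1 = (a $ i, 1)"
    using \<sigma>(3,4) by simp_all
  show "k \<ge> 1 \<Longrightarrow> iter_deriv {0..1} k (\<sigma> i) 0 = iter_deriv {0..1} k (\<sigma> i) 1"
    using \<sigma>(5) unfolding meets_ends_orthogonally_def by blast
  show "i \<noteq> j \<Longrightarrow> s \<in> {0..1} \<Longrightarrow> t \<in> {0..1} \<Longrightarrow> \<sigma> i s \<noteq> \<sigma> j t"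
    using \<sigma>(6) by (metis IntI empty_iff imageI)
qed

lemma deriv_family_slink:
  "deriv_family (slink_space a) (\<lambda>\<sigma>. iter_deriv {0..1} k (\<sigma> i)) (\<lambda>\<sigma>. iter_deriv {0..1} (Suc k) (\<sigma> i))"
  unfolding deriv_family_def topspace_slink_space
proof (intro ballI)
  fix \<sigma> and t :: real assume "\<sigma> \<in> slink a" "t \<in> {0..1}"
  then have "iter_deriv {0..1} k (\<sigma> i) differentiable (at t within {0..1})"
    using slinkD(3)[of \<sigma> a i] unfolding smooth_immersed_curve_def differentiable_on_def by blast
  then show "(iter_deriv {0..1} k (\<sigma> i) has_vector_derivative iter_deriv {0..1} (Suc k) (\<sigma> i) t)
      (at t within {0..1})"
    by (simp add: vector_derivative_works)
qed

text \<open>A strand is no loop, so the count starts at its first derivative; from there on the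
  values at both ends agree by \<open>meets_ends_orthogonally\<close>.\<close>

lemma Ck_loops_slink_deriv:
  "Ck_loops (slink_space a) m (\<lambda>\<sigma>. iter_deriv {0..1} (Suc k) (\<sigma> i))"
proof (induction m arbitrary: k)
  have loop: "loop_family (slink_space a) (\<lambda>\<sigma>. iter_deriv {0..1} (Suc k) (\<sigma> i))" for k
    unfolding loop_family_def topspace_slink_space
    by (intro conjI ballI continuous_family_slink slinkD(6)) auto
  {
    case 0
    show ?case
      using loop unfolding Ck_loops.simps by blast
  next
    case (Suc m)
    then show ?case
      using loop deriv_family_slink unfolding Ck_loops.simps by blast
  }
qed

lemma Ck_loops_slink_compose:
  assumes U: "open U" "cball 0 1 \<times> UNIV \<subseteq> U" and B: "smooth_on U B"
    "\<And>x z. x \<in> cball 0 1 \<Longrightarrow> B (x, z + 1) = B (x, z)"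
  shows "Ck_loops (slink_space a) m (\<lambda>\<sigma> t. B (\<sigma> i t))"
proof (rule Ck_loops_compose_periodic[OF U, where p = "\<lambda>\<sigma>. a $ i"])
  show "continuous_family (slink_space a) {0..1} (\<lambda>\<sigma>. \<sigma> i)"
    using continuous_family_slink[of a 0 i] by simp
  show "deriv_family (slink_space a) (\<lambda>\<sigma>. \<sigma> i) (\<lambda>\<sigma>. iter_deriv {0..1} (Suc 0) (\<sigma> i))"
    using deriv_family_slink[of a 0 i] by simp
qed (use B in \<open>auto simp: topspace_slink_space slinkD simp del: iter_deriv.simps
    intro: Ck_loops_slink_deriv\<close>)

section \<open>The closure as a map of function spaces\<close>

lemma closure_map_wrap_frac:
  "closure_map b \<sigma> i (wrap t) = b (\<sigma> i (frac t))"
  by (simp add: closure_map_def wrap_in_circle unwrap_wrap)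

lemma frac_in_unit_interval: "frac (t::real) \<in> {0..1}"
  by (simp add: frac_lt_1 less_imp_le)

text \<open>The closed curve is the periodic extension of \<open>B\<close> along a strand, hence
  smooth, and immersed as \<open>B\<close> has injective derivative. Different components stay
  disjoint because \<open>b\<close> glues only end points over the same point of the disk, while the
  \<open>a $ i\<close> are distinct.\<close>

lemma closure_map_in_link:
  assumes b: "bends_cylinder b" and a: "a \<in> Conf (cball 0 1)" and \<sigma>: "\<sigma> \<in> slink a"
  shows "closure_map b \<sigma> \<in> link (glued_points b a)"
proof -
  obtain U B where U: "open U" "cball 0 1 \<times> UNIV \<subseteq> U" and B: "smooth_on U B"
    and inj: "\<forall>p\<in>cylinder. inj (frechet_derivative B (at p))"
    and per: "\<forall>x\<in>cball 0 1. \<forall>z. B (x, z + 1) = B (x, z)" and bB: "\<forall>p\<in>cylinder. b p = B p"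
    by (rule bends_cylinderE[OF b]) (rule that)
  have smooth: "smooth_immersed_curve UNIV (closure_map b \<sigma> i \<circ> wrap)" for i
  proof -
    have eq: "closure_map b \<sigma> i \<circ> wrap = (\<lambda>t. B (\<sigma> i (frac t)))"
      using slinkD(1)[OF \<sigma> frac_in_unit_interval] by (auto simp: closure_map_wrap_frac bB)
    have loops: "Ck_loops (slink_space a) m (\<lambda>\<sigma> t. B (\<sigma> i t))" for m
      using per by (intro Ck_loops_slink_compose[OF U B]) blast
    have \<sigma>S: "\<sigma> \<in> topspace (slink_space a)"
      using \<sigma> by (simp add: topspace_slink_space)
    have diff: "iter_deriv UNIV k (\<lambda>t. B (\<sigma> i (frac t))) differentiable_on UNIV" for k
      using differentiable_iter_deriv_frac[OF loops \<sigma>S] .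
    obtain G where G: "loop_family (slink_space a) (\<lambda>\<sigma> t. B (\<sigma> i t))"
      "deriv_family (slink_space a) (\<lambda>\<sigma> t. B (\<sigma> i t)) G" "loop_family (slink_space a) G"
      using loops[of "Suc 0"] unfolding Ck_loops.simps by blast
    \<comment> \<open>\<open>G\<close> is only known to exist. Uniqueness of derivatives on
      \<open>{0..1}\<close> identifies it with the image of the velocity of the strand under the
      derivative of \<open>B\<close>.\<close>
    have nz: "G \<sigma> t \<noteq> 0" if t: "t \<in> {0..1}" for t
    proof -
      have cyl: "\<sigma> i t \<in> cylinder"
        by (rule slinkD(1)[OF \<sigma> t])
      then have "\<sigma> i t \<in> U"
        using U by (auto simp: cylinder_def)
      then have D: "(B has_derivative frechet_derivative B (at (\<sigma> i t))) (at (\<sigma> i t))"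
        by (rule smooth_on_has_derivative[OF B U(1)])
      have "(\<sigma> i has_vector_derivative iter_deriv {0..1} 1 (\<sigma> i) t) (at t within {0..1})"
        using deriv_family_slink[of a 0 i] \<sigma>S t by (simp add: deriv_family_def)
      then have "((B \<circ> \<sigma> i) has_vector_derivative
          frechet_derivative B (at (\<sigma> i t)) (iter_deriv {0..1} 1 (\<sigma> i) t)) (at t within {0..1})"
        using has_derivative_at_withinI[OF D] by (rule vector_derivative_diff_chain_within)
      moreover have "((B \<circ> \<sigma> i) has_vector_derivative G \<sigma> t) (at t within {0..1})"
        using G(2) \<sigma>S t by (simp add: deriv_family_def o_def)
      ultimately have "G \<sigma> t = frechet_derivative B (at (\<sigma> i t)) (iter_deriv {0..1} 1 (\<sigma> i) t)"
        using vector_derivative_unique_within_closed_interval[of 0 1 t] t by (metis box_real(2) zero_less_one)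
      moreover have "iter_deriv {0..1} 1 (\<sigma> i) t \<noteq> 0"
        using slinkD(3)[OF \<sigma>, of i] t unfolding smooth_immersed_curve_def by blast
      moreover have "linear (frechet_derivative B (at (\<sigma> i t)))"
        using D by (rule has_derivative_linear)
      ultimately show ?thesis
        using inj cyl linear_injective_0 by metis
    qed
    have "iter_deriv UNIV 1 (\<lambda>t. B (\<sigma> i (frac t))) t \<noteq> 0" for t
      using iter_deriv_frac_Suc[OF G \<sigma>S, of 0] nz[OF frac_in_unit_interval[of t]]
      by (simp del: iter_deriv.simps(2))
    with diff show ?thesis
      unfolding eq smooth_immersed_curve_def by blast
  qed
  have disj: "b (\<sigma> i s) \<noteq> b (\<sigma> j t)" if ij: "i \<noteq> j" and s: "s \<in> {0..1}" and t: "t \<in> {0..1}" for i j s t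
  proof
    assume "b (\<sigma> i s) = b (\<sigma> j t)"
    then have *: "fst (\<sigma> i s) = fst (\<sigma> j t)" "{snd (\<sigma> i s), snd (\<sigma> j t)} = {0, 1}"
      using bends_cylinder_eq_iff[OF b slinkD(1)[OF \<sigma> s] slinkD(1)[OF \<sigma> t]] slinkD(7)[OF \<sigma> ij s t]
      by blast+
    \<comment> \<open>Interior parameters go to the open cylinder, so height 0 or 1 is reached only
      at the ends of a strand.\<close>
    have end_point: "fst (\<sigma> l u) = a $ l" if "u \<in> {0..1}" "snd (\<sigma> l u) \<in> {0, 1}" for l u
    proof -
      have "\<not> u \<in> {0<..<1}"
        using slinkD(2)[OF \<sigma>, of u l] that(2) by (auto simp: interior_cylinder)
      then have "u = 0 \<or> u = 1"
        using that(1) by auto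
      then show ?thesis
        using slinkD(4,5)[OF \<sigma>] by auto
    qed
    have "snd (\<sigma> i s) \<in> {0, 1}" "snd (\<sigma> j t) \<in> {0, 1}"
      using *(2) by blast+
    then have "a $ i = a $ j"
      using end_point s t *(1) by metis
    then show False
      using a ij by (auto simp: Conf_def)
  qed
  have "closure_map b \<sigma> i ` circle \<inter> closure_map b \<sigma> j ` circle = {}" if "i \<noteq> j" for i j
    using disj[OF that] frac_in_unit_interval
    unfolding wrap_image[symmetric] by (auto simp: closure_map_wrap_frac)
  moreover have "closure_map b \<sigma> i 1 = glued_points b a $ i" for i
    using closure_map_wrap_frac[of b \<sigma> i 0] slinkD(4)[OF \<sigma>]
    by (simp add: wrap_def glued_points_def)
  moreover have "closure_map b \<sigma> i \<in> extensional circle" for i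
    by (simp add: closure_map_def)
  ultimately show ?thesis
    using smooth by (simp add: link_def)
qed

text \<open>Continuity into the pullback topology means that all derivatives of the closed link vary
  continuously; these are derivatives of families that are \<open>Ck_loops\<close> of every
  order.\<close>

lemma continuous_map_closure_map:
  fixes a :: "(real^2)^'n"
  assumes b: "bends_cylinder b" and a: "a \<in> Conf (cball 0 1)"
  shows "continuous_map (slink_space a) (link_space (glued_points b a)) (closure_map b)"
  unfolding link_space_def
proof (rule continuous_map_pullback')
  obtain U B where U: "open U" "cball 0 1 \<times> UNIV \<subseteq> U" and B: "smooth_on U B"
    and per: "\<forall>x\<in>cball 0 1. \<forall>z. B (x, z + 1) = B (x, z)" and bB: "\<forall>p\<in>cylinder. b p = B p"
    by (rule bends_cylinderE[OF b]) (rule that)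
  have "continuous_family (slink_space a) {0..1} (\<lambda>\<sigma>. iter_deriv UNIV k (closure_map b \<sigma> i \<circ> wrap))"
    for k and i :: 'n
  proof -
    have eq: "closure_map b \<sigma> i \<circ> wrap = (\<lambda>t. B (\<sigma> i (frac t)))" if "\<sigma> \<in> slink a" for \<sigma>
      using slinkD(1)[OF that frac_in_unit_interval] by (auto simp: closure_map_wrap_frac bB)
    have "continuous_family (slink_space a) {0..1} (\<lambda>\<sigma>. iter_deriv UNIV k (closure_map b \<sigma> i \<circ> wrap)) \<longleftrightarrow>
        continuous_family (slink_space a) {0..1} (\<lambda>\<sigma>. iter_deriv UNIV k (\<lambda>t. B (\<sigma> i (frac t))))"
      by (rule continuous_family_cong) (simp only: eq topspace_slink_space)
    then show ?thesis
      using continuous_family_iter_deriv_frac[OF Ck_loops_slink_compose[OF U B]] per by blast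
  qed
  then have "continuous_map (slink_space a) (uniform_topology {0..1})
      (\<lambda>\<sigma>. jets UNIV (\<lambda>i. closure_map b \<sigma> i \<circ> wrap) ki)" for ki
    by (cases ki) (simp add: jets_def continuous_family_iff)
  then show "continuous_map (slink_space a) jet_topology
      ((\<lambda>L. jets UNIV (\<lambda>i. L i \<circ> wrap)) \<circ> closure_map b)"
    unfolding jet_topology_def continuous_map_componentwise_UNIV by (simp add: o_def)
  show "topspace (slink_space a) \<subseteq> closure_map b -` link (glued_points b a)"
    using closure_map_in_link[OF b a] by (auto simp: topspace_slink_space)
qed

section \<open>Configuration-valued maps\<close>

text \<open>Coordinate projections are open maps, so the image of the interior is an open subset of
  \<open>S\<close>.\<close>

lemma interior_Conf_component:
  assumes "x \<in> interior (Conf S :: ('a::topological_space^'n) set)"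
  shows "x $ i \<in> interior S"
proof (rule interiorI)
  show "open ((\<lambda>x. x $ i) ` interior (Conf S :: ('a^'n) set))"
    by (intro open_image_vec_nth open_interior)
  show "(\<lambda>x. x $ i) ` interior (Conf S :: ('a^'n) set) \<subseteq> S"
    using interior_subset by (fastforce simp: Conf_def)
qed (use assms in blast)

section \<open>From string links to maps of the cube\<close>

text \<open>Component \<open>i\<close> depends on the coordinate \<open>t $ i\<close> alone.
  Periodicity is then immediate, and the support conditions reduce to the strands being interior at
  interior parameters.\<close>

lemma kappa_check_in_cube_maps:
  fixes a :: "(real^2)^'n"
  assumes \<sigma>: "\<sigma> \<in> slink a"
  shows "kappa_check \<sigma> \<in> cube_maps a"
proof -
  have val: "kappa_check \<sigma> t $ i = \<sigma> i (t $ i)" if "t \<in> unit_cube" for t i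
    using that by (simp add: kappa_check_def)
  have coord: "t $ i \<in> {0..1}" if "t \<in> unit_cube" for t :: "real^'n" and i
    using that by (simp add: unit_cube_def)
  have "continuous_on {0..1} (\<sigma> i)" for i
    using continuous_family_slink[of a 0 i] \<sigma> by (simp add: continuous_family_def topspace_slink_space)
  then have "continuous_on unit_cube (\<lambda>t. \<sigma> i (t $ i))" for i
    by (rule continuous_on_compose2) (use coord in \<open>auto intro!: continuous_intros\<close>)
  then have "continuous_on unit_cube (\<lambda>t. \<chi> i. \<sigma> i (t $ i))"
    by (rule continuous_on_vec_lambda)
  then have "continuous_on unit_cube (kappa_check \<sigma>)"
    by (simp add: kappa_check_def cong: continuous_on_cong)
  moreover have "kappa_check \<sigma> t \<in> Conf cylinder" if "t \<in> unit_cube" for t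
    using slinkD(1,7)[OF \<sigma>] coord[OF that] that by (simp add: Conf_def val)
  moreover have "interior_support (kappa_check \<sigma>)"
  proof -
    have "kappa_check \<sigma> t \<in> Conf (interior cylinder)" if t: "t \<in> interior unit_cube" for t
    proof -
      have "t \<in> unit_cube" "\<And>i. t $ i \<in> {0<..<1}"
        using t interior_subset by (blast, simp add: interior_unit_cube)
      then show ?thesis
        using slinkD(2,7)[OF \<sigma>] coord by (simp add: Conf_def val)
    qed
    \<comment> \<open>Configurations in an open set form an open set, so they lie in the
      interior.\<close>
    moreover have "Conf (interior cylinder) \<subseteq> interior (Conf cylinder :: (((real^2) \<times> real)^'n) set)"
      using interior_subset by (intro interior_maximal open_Conf) (auto simp: Conf_def)
    ultimately show ?thesis
      by (auto simp: interior_support_def)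
  qed
  moreover have "endpoints a (kappa_check \<sigma>)"
    using slinkD(4,5)[OF \<sigma>] by (simp add: endpoints_def val)
  moreover have "periodicity (kappa_check \<sigma>)"
    by (simp add: periodicity_def val)
  moreover have "facewise_support (kappa_check \<sigma>)"
    using slinkD(2)[OF \<sigma>] by (simp add: facewise_support_def val)
  moreover have "kappa_check \<sigma> \<in> extensional unit_cube"
    by (simp add: kappa_check_def)
  ultimately show ?thesis
    by (auto simp: cube_maps_def)
qed

lemma continuous_map_kappa_check:
  "continuous_map (slink_space a) (cube_map_space a) kappa_check"
  unfolding cube_map_space_def continuous_map_in_subtopology
proof
  have "continuous_family (slink_space a) unit_cube (\<lambda>\<sigma> t. \<sigma> i (t $ i))" for i
    using continuous_family_slink[of a 0 i]
    by (intro continuous_family_reparametrize[where h = "\<lambda>t. t $ i" and K = "{0..1}"])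
      (auto simp: unit_cube_def intro!: continuous_intros)
  then have "continuous_family (slink_space a) unit_cube (\<lambda>\<sigma> t. \<chi> i. \<sigma> i (t $ i))"
    by (rule continuous_family_vec_lambda)
  then show "continuous_map (slink_space a) (uniform_topology unit_cube) kappa_check"
    by (simp add: continuous_family_iff compact_unit_cube kappa_check_def[abs_def])
  show "kappa_check \<in> topspace (slink_space a) \<rightarrow> cube_maps a"
    by (simp add: topspace_slink_space kappa_check_in_cube_maps)
qed

section \<open>Koschorke's map\<close>

text \<open>The link topology speaks of curves on \<open>{0..1}\<close>; these descend along
  \<open>wrap\<close> to the circle, and the coordinate projections carry the result to the
  torus.\<close>

lemma continuous_family_kappa:
  "continuous_family (link_space a) torus (\<lambda>L x. \<chi> i. L i (x $ i))"
proof -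
  have "continuous_family (link_space a) circle (\<lambda>L. L i)" for i
    by (rule continuous_family_quotient[OF continuous_on_wrap _ wrap_image continuous_family_link]) simp
  then have "continuous_family (link_space a) torus (\<lambda>L x. L i (x $ i))" for i
    by (rule continuous_family_reparametrize) (auto simp: torus_def intro!: continuous_intros)
  then show ?thesis
    by (rule continuous_family_vec_lambda)
qed

lemma kappa_in_torus_maps:
  assumes L: "L \<in> link a"
  shows "kappa L \<in> torus_maps a"
proof -
  have "continuous_on torus (\<lambda>x. \<chi> i. L i (x $ i))"
    using continuous_family_kappa[of a] L by (simp add: continuous_family_def topspace_link_space)
  then have "continuous_on torus (kappa L)"
    by (simp add: kappa_def cong: continuous_on_cong)
  moreover have "kappa L x \<in> Conf UNIV" if x: "x \<in> torus" for x
  proof -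
    have "L i (x $ i) \<noteq> L j (x $ j)" if "i \<noteq> j" for i j
    proof -
      have "L i ` circle \<inter> L j ` circle = {}"
        using L that by (simp add: link_def)
      then show ?thesis
        using x by (auto simp: torus_def disjoint_iff)
    qed
    with x show ?thesis
      by (simp add: kappa_def Conf_def)
  qed
  moreover have "kappa L (\<chi> i. 1) = a"
    using L by (simp add: kappa_def torus_def circle_def link_def vec_eq_iff)
  moreover have "kappa L \<in> extensional torus"
    by (simp add: kappa_def)
  ultimately show ?thesis
    by (auto simp: torus_maps_def)
qed

lemma continuous_map_kappa: "continuous_map (link_space a) (torus_map_space a) kappa"
  unfolding torus_map_space_def continuous_map_in_subtopology
  using continuous_family_kappa[of a]
  by (simp add: continuous_family_iff compact_torus kappa_def[abs_def, symmetric]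
      topspace_link_space kappa_in_torus_maps)

section \<open>From maps of the cube to maps of the torus\<close>

text \<open>\<open>b_hat\<close> evaluates at the representative whose coordinates are below 1, so
  the content lies at coordinates equal to 1. There the component with the same index is handled by
  the gluing of \<open>b\<close>, the others by periodicity.\<close>

lemma b_hat_wrap_torus:
  fixes a :: "(real^2)^'n"
  assumes b: "bends_cylinder b" and a: "a \<in> Conf (cball 0 1)" and f: "f \<in> cube_maps a"
    and t: "t \<in> unit_cube"
  shows "b_hat b f (wrap_torus t) = (\<chi> i. b (f t $ i))"
proof -
  \<comment> \<open>Moving the coordinates in \<open>J\<close> from 1 to 0 one after the other does not change \<open>b \<circ> f\<close>.\<close>
  define u where "u J = (\<chi> j. if j \<in> J then frac (t $ j) else t $ j)" for J
  have u_cube: "u J \<in> unit_cube" for J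
    using t frac_in_unit_interval by (auto simp: u_def unit_cube_def)
  have per: "periodicity f" and ends: "endpoints a f"
    using f by (auto simp: cube_maps_def)
  have "b (f (u J) $ i) = b (f t $ i)" for J i
  proof (induction J rule: finite_induct[OF finite])
    case 1
    then show ?case
      by (simp add: u_def)
  next
    case (2 j J)
    show ?case
    proof (cases "t $ j = 1")
      case False
      then have "frac (t $ j) = t $ j"
        using t by (auto simp: unit_cube_def frac_eq less_le)
      then have "u (insert j J) = u J"
        by (auto simp: u_def vec_eq_iff)
      then show ?thesis
        using 2 by simp
    next
      case True
      then have j: "u (insert j J) $ j = 0" "u J $ j = 1"
        using 2(2) by (auto simp: u_def)
      have "b (f (u (insert j J)) $ i) = b (f (u J) $ i)"
      proof (cases "i = j")
        case True
        then have "f (u (insert j J)) $ i = (a $ j, 0)" "f (u J) $ i = (a $ j, 1)"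
          using ends u_cube j by (auto simp: endpoints_def)
        then show ?thesis
          using bends_cylinder_ends[OF b] a by (simp add: Conf_def)
      next
        case False
        moreover have "\<forall>l. l \<noteq> j \<longrightarrow> u (insert j J) $ l = u J $ l"
          by (simp add: u_def)
        ultimately have "f (u (insert j J)) $ i = f (u J) $ i"
          using per u_cube j unfolding periodicity_def by blast
        then show ?thesis
          by simp
      qed
      then show ?thesis
        using 2(3) by simp
    qed
  qed
  moreover have "unwrap_torus (wrap_torus t) = u UNIV"
    by (simp add: u_def unwrap_torus_def wrap_torus_def unwrap_wrap)
  ultimately show ?thesis
    by (simp add: b_hat_def wrap_torus_in_torus)
qed

lemma continuous_family_b_hat:
  assumes b: "bends_cylinder b" and a: "a \<in> Conf (cball 0 1)"
  shows "continuous_family (cube_map_space a) torus (b_hat b)"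
proof (rule continuous_family_quotient[OF continuous_on_wrap_torus compact_unit_cube wrap_torus_image])
  \<comment> \<open>The inclusion of a subspace is continuous, so the maps of the cube form a
    tautological continuous family.\<close>
  have "continuous_map (cube_map_space a) (uniform_topology unit_cube) (\<lambda>f. f)"
    unfolding cube_map_space_def by (simp add: continuous_map_from_subtopology)
  then have id: "continuous_family (cube_map_space a) unit_cube (\<lambda>f. f)"
    by (simp add: continuous_map_uniform_topology[OF compact_unit_cube] continuous_family_def)
  have "continuous_family (cube_map_space a) unit_cube (\<lambda>f t. b (f t $ i))" for i
  proof (rule continuous_family_compose[OF _ _ continuous_on_bends_cylinder[OF b] compact_cylinder])
    show "continuous_family (cube_map_space a) unit_cube (\<lambda>f t. f t $ i)"
      using bounded_linear_vec_nth id by (rule continuous_family_bounded_linear)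
    show "f t $ i \<in> cylinder" if "f \<in> topspace (cube_map_space a)" "t \<in> unit_cube" for f t
      using that by (auto simp: topspace_cube_map_space cube_maps_def Conf_def)
  qed
  then have "continuous_family (cube_map_space a) unit_cube (\<lambda>f t. \<chi> i. b (f t $ i))"
    by (rule continuous_family_vec_lambda)
  moreover have "continuous_family (cube_map_space a) unit_cube (\<lambda>f t. \<chi> i. b (f t $ i)) \<longleftrightarrow>
      continuous_family (cube_map_space a) unit_cube (\<lambda>f t. b_hat b f (wrap_torus t))"
    by (rule continuous_family_cong) (simp add: topspace_cube_map_space b_hat_wrap_torus[OF b a])
  ultimately show "continuous_family (cube_map_space a) unit_cube (\<lambda>f t. b_hat b f (wrap_torus t))"
    by blast
qed

text \<open>As \<open>f t\<close> is a configuration, \<open>b\<close> could only identify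
  components at heights 0 and 1. If coordinate \<open>i\<close> or \<open>j\<close> is 0,
  periodicity turns this into a collision on the opposite face; otherwise both are interior and the
  support conditions keep component \<open>i\<close> off the end disks.\<close>

lemma cube_map_not_glued:
  fixes a :: "(real^2)^'n"
  assumes b: "bends_cylinder b" and f: "f \<in> cube_maps a"
    and t: "t \<in> unit_cube" "\<And>k. t $ k < 1" and ij: "i \<noteq> j"
  shows "b (f t $ i) \<noteq> b (f t $ j)"
proof
  assume eq: "b (f t $ i) = b (f t $ j)"
  have conf: "f u \<in> Conf cylinder" if "u \<in> unit_cube" for u
    using f that by (auto simp: cube_maps_def)
  have ends: "endpoints a f" and per: "periodicity f"
    using f by (auto simp: cube_maps_def)
  have glued: "fst (f t $ i) = fst (f t $ j)" "{snd (f t $ i), snd (f t $ j)} = {0, 1}"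
    using eq conf[OF t(1)] ij bends_cylinder_eq_iff[OF b, of "f t $ i" "f t $ j"]
    by (auto simp: Conf_def)
  have no_end: "t $ k \<noteq> 0" if kl: "k \<noteq> l" and fst: "fst (f t $ k) = fst (f t $ l)"
    and snd: "{snd (f t $ k), snd (f t $ l)} = {0, 1}" for k l
  proof
    assume k: "t $ k = 0"
    then have fk: "f t $ k = (a $ k, 0)"
      using ends t(1) by (simp add: endpoints_def)
    then have fl: "f t $ l = (a $ k, 1)"
      using fst snd by (auto simp: prod_eq_iff doubleton_eq_iff)
    \<comment> \<open>On the opposite face \<open>t\<^sub>k = 1\<close> the components \<open>k\<close> and \<open>l\<close> would collide.\<close>
    define u where "u = (\<chi> m. if m = k then 1 else t $ m)"
    have u: "u \<in> unit_cube" "u $ k = 1" "\<forall>m. m \<noteq> k \<longrightarrow> t $ m = u $ m"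
      using t(1) by (auto simp: u_def unit_cube_def)
    have "f u $ l = f t $ l"
      using per kl t(1) u k unfolding periodicity_def by metis
    moreover have "f u $ k = (a $ k, 1)"
      using ends u by (simp add: endpoints_def)
    moreover have "f u $ k \<noteq> f u $ l"
      using conf[OF u(1)] kl unfolding Conf_def by blast
    ultimately show False
      using fl by simp
  qed
  have "t $ i \<noteq> 0" "t $ j \<noteq> 0"
    using no_end[of i j] no_end[of j i] ij glued by (auto simp: insert_commute)
  moreover have "0 \<le> t $ k" for k
    using t(1) by (simp add: unit_cube_def)
  ultimately have "t $ i \<in> {0<..<1}" "t $ j \<in> {0<..<1}"
    using t(2) by (auto simp: less_le)
  moreover have "interior_support f" "facewise_support f"
    using f by (auto simp: cube_maps_def)
  \<comment> \<open>\<open>interior_support\<close> covers the case that \<open>t\<close> is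
    interior to the cube, \<open>facewise_support\<close> the case that some third coordinate is
    0.\<close>
  ultimately have "f t $ i \<in> interior cylinder"
    using t(1) ij interior_Conf_component[of "f t" cylinder i]
    unfolding interior_support_def facewise_support_def by blast
  then have "snd (f t $ i) \<notin> {0, 1}"
    by (auto simp: interior_cylinder)
  then show False
    using glued(2) by blast
qed

lemma b_hat_in_torus_maps:
  fixes a :: "(real^2)^'n"
  assumes b: "bends_cylinder b" and a: "a \<in> Conf (cball 0 1)" and f: "f \<in> cube_maps a"
  shows "b_hat b f \<in> torus_maps (glued_points b a)"
proof -
  have "continuous_on torus (b_hat b f)"
    using continuous_family_b_hat[OF b a] f
    by (simp add: continuous_family_def topspace_cube_map_space)
  \<comment> \<open>\<open>unwrap\<close> never takes the value 1, which puts the point in the range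
    of \<open>cube_map_not_glued\<close>.\<close>
  moreover have "b_hat b f x \<in> Conf UNIV" if "x \<in> torus" for x
    using that cube_map_not_glued[OF b f unwrap_torus_in_unit_cube] unwrap_bounds
    by (simp add: b_hat_def Conf_def unwrap_torus_def)
  moreover have "b_hat b f (\<chi> i. 1) = glued_points b a"
  proof -
    have "(\<chi> i. 1) = (wrap_torus 0 :: complex^'n)" "(0 :: real^'n) \<in> unit_cube"
      by (simp_all add: wrap_torus_def wrap_def unit_cube_def)
    moreover from this(2) have "f 0 $ i = (a $ i, 0)" for i
      using f by (simp add: cube_maps_def endpoints_def)
    ultimately show ?thesis
      using b_hat_wrap_torus[OF b a f, of 0] by (simp add: glued_points_def)
  qed
  moreover have "b_hat b f \<in> extensional torus"
    by (simp add: b_hat_def)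
  ultimately show ?thesis
    by (auto simp: torus_maps_def)
qed

lemma continuous_map_b_hat:
  fixes a :: "(real^2)^'n"
  assumes b: "bends_cylinder b" and a: "a \<in> Conf (cball 0 1)"
  shows "continuous_map (cube_map_space a) (torus_map_space (glued_points b a)) (b_hat b)"
proof -
  have "restrict (b_hat b f) torus = b_hat b f" for f :: "real^'n \<Rightarrow> ((real^2) \<times> real)^'n"
    by (simp add: b_hat_def)
  then show ?thesis
    unfolding torus_map_space_def continuous_map_in_subtopology
    using continuous_family_b_hat[OF b a] b_hat_in_torus_maps[OF b a]
    by (simp add: continuous_family_iff compact_torus topspace_cube_map_space)
qed

section \<open>Commutativity of the square\<close>

text \<open>Both sides evaluate strand \<open>i\<close> at \<open>unwrap (x $ i)\<close> and then
  apply \<open>b\<close>.\<close>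

lemma b_hat_kappa_check: "b_hat b (kappa_check \<sigma>) = kappa (closure_map b \<sigma>)"
proof -
  have "kappa_check \<sigma> (unwrap_torus x) $ i = \<sigma> i (unwrap (x $ i))" for x i
    by (simp add: kappa_check_def unwrap_torus_in_unit_cube) (simp add: unwrap_torus_def)
  then show ?thesis
    by (auto simp: b_hat_def kappa_def closure_map_def torus_def vec_eq_iff)
qed

theorem mainTheorem2:
  fixes a :: "(real^2)^'n" and b :: "(real^2) \<times> real \<Rightarrow> real^3"
  assumes "CARD('n) \<ge> 2"
    and "a \<in> Conf (cball 0 1)"
    and "bends_cylinder b"
  shows
    "(\<forall>f \<in> cube_maps a. b_hat b f \<in> torus_maps (glued_points b a) \<and>
        (\<forall>t \<in> unit_cube. b_hat b f (wrap_torus t) = (\<chi> i. b (f t $ i)))) \<and>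
     kappa_check ` slink a \<subseteq> cube_maps a \<and>
     closure_map b ` slink a \<subseteq> link (glued_points b a) \<and>
     kappa ` link (glued_points b a) \<subseteq> torus_maps (glued_points b a) \<and>
     (\<forall>\<sigma> \<in> slink a. b_hat b (kappa_check \<sigma>) = kappa (closure_map b \<sigma>)) \<and>
     (let S = slink_space a; M = cube_map_space a;
          L = link_space (glued_points b a); N = torus_map_space (glued_points b a)
      in continuous_map S M kappa_check \<and> continuous_map M N (b_hat b) \<and>
         continuous_map S L (closure_map b) \<and> continuous_map L N kappa \<and>
         (\<forall>P \<in> path_components_of S.
            pi0_map M N (b_hat b) (pi0_map S M kappa_check P) =
            pi0_map L N kappa (pi0_map S L (closure_map b) P)))"
proof -
  note b = assms(3) and a = assms(2)
  let ?S = "slink_space a" and ?M = "cube_map_space a"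
  let ?L = "link_space (glued_points b a)" and ?N = "torus_map_space (glued_points b a)"
  note cont = continuous_map_kappa_check[of a] continuous_map_b_hat[OF b a]
    continuous_map_closure_map[OF b a] continuous_map_kappa[of "glued_points b a"]
  \<comment> \<open>The composites agree as functions, so functoriality of \<open>pi0_map\<close>
    yields the square on path components.\<close>
  have "b_hat b \<circ> kappa_check = kappa \<circ> (closure_map b :: ('n \<Rightarrow> _) \<Rightarrow> _)"
    by (simp add: o_def b_hat_kappa_check)
  then have "pi0_map ?M ?N (b_hat b) (pi0_map ?S ?M kappa_check P) =
      pi0_map ?L ?N kappa (pi0_map ?S ?L (closure_map b) P)"
    if "P \<in> path_components_of ?S" for P
    using pi0_map_compose[OF cont(1,2) that] pi0_map_compose[OF cont(3,4) that] by simp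
  with cont show ?thesis
    using b_hat_in_torus_maps[OF b a] b_hat_wrap_torus[OF b a] kappa_check_in_cube_maps
      closure_map_in_link[OF b a] kappa_in_torus_maps b_hat_kappa_check
    unfolding Let_def by (intro conjI ballI image_subsetI) blast+
qed

end
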